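(* Let $n,k$ be positive integers with $n\ge 4k+\binom{k+1}{2}$. The poset $NG_3(n,k)$ is an amphora under majorization. Moreover, there is a bijection that preserves majorization between $NG_3(n,k)$ and the amphora $A(n-4k,k)$ of split blocks.
   Context: $Dis(n)$ is the set of partitions of $n$ into distinct positive parts, written in decreasing order; $Dis_k(n)$ is the subset of those with exactly $k$ parts; $\mathrm{len}$ is the number of parts. For $\gamma=(g_1,\dots,g_r)$ a partition of $n_1$ and $\delta=(d_1,\dots,d_s)$ a partition of $n_2$, $\delta\succeq_w\gamma$ means $n_2\ge n_1$ and $\sum_{i=1}^m d_i\ge\sum_{i=1}^m g_i$ for all $m\le\min\{r,s\}$; $\delta\succeq\gamma$ ($\delta$ majorizes $\gamma$) means in addition $n_1=n_2$. For positive integers $n_1\le n_2$ of the same parity, a block is an ordered pair $[\alpha|\beta]$ with $\alpha\in Dis(n_1)$, $\beta\in Dis(n_2)$, $\beta\succeq_w\alpha$ and $\mathrm{len}(\alpha)\in\{\mathrm{len}(\beta),\mathrm{len}(\beta)+1\}$; it is a split block ($S$-block) if $n_1=n_2$. For blocks with $\alpha_1,\alpha_2\in Dis(n_1)$, $\beta_1,\beta_2\in Dis(n_2)$, $[\alpha_1|\beta_1]\succeq[\alpha_2|\beta_2]$ (majorization) means $\alpha_1\succeq\alpha_2$ and $\beta_1\preceq\beta_2$. $A(n,k)$ is the poset, under majorization, of all $S$-blocks $[\alpha|\beta]$ with $\alpha,\beta\in Dis_k(n)$. Graphs are finite and simple, without isolated vertices. For a degree sequence $\pi=(d_1\ge\dots\ge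 d_r)$, $\alpha(\pi)$ has $i$-th part $d_i-i+1$ for those $i$ with $d_i\ge i$, and $\beta(\pi)$ has $j$-th part $|\{i:d_i\ge j\}|-j$ for those $j$ for which this is positive. A graph $G$ is an NG-graph if $\chi(G)+\chi(\overline G)=|V(G)|+1$; with $A_G=\{v:\deg(v)=\chi(G)-1\}$, an NG-graph is an NG-3 graph if $G[A_G]$ is a 5-cycle. A block $[\alpha|\beta]$ is an NG-3 block if there is an NG-3 graph with degree sequence $\pi$ such that $\alpha=\alpha(\pi)$, $\beta=\beta(\pi)$. The elements of the poset $NG_3(n,k)$ are the NG-3 blocks $[\alpha|\beta]$ for which $\alpha$ has smallest parts $2,1$, $\beta$ has smallest parts $4,3$, and the partitions $\tilde\alpha,\tilde\beta$ obtained by removing the smallest two parts of $\alpha$ and $\beta$ respectively satisfy: (i) $\tilde\alpha,\tilde\beta\in Dis_k(n)$; (ii) the smallest part of $\tilde\alpha$ is at least $3$; (iii) the smallest part of $\tilde\beta$ is at least $5$. Its order relation is majorization of blocks. Given a poset $P$, a subposet $P'$ is an amphora if there exist an antichain $A$ in $P$ and an element $x$ less than or equal to every element of $A$ such that $P'$ consists of all elements of $P$ that are greater than or equal to $x$ and less than or equal to some element of $A$. For $NG_3(n,k)$ the ambient poset $P$ is $NG_3(n,k)$ itself. A bijection $\varphi$ between posets of blocks preserves majorization if $x\succeq y\iff\varphi(x)\succeq\varphi(y)$. *)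

theory Defs
  imports Main "HOL-Library.Multiset" "HOL-Library.Ramsey"
begin

section \<open>Partitions into distinct parts, majorization, blocks\<close>

definition Dis :: "nat \<Rightarrow> nat list set" where
  "Dis n = {xs. sorted_wrt (>) xs \<and> (\<forall>x\<in>set xs. 0 < x) \<and> sum_list xs = n}"

definition Dis_len :: "nat \<Rightarrow> nat \<Rightarrow> nat list set" where
  "Dis_len k n = {xs \<in> Dis n. length xs = k}"

definition weakly_majorizes :: "nat list \<Rightarrow> nat list \<Rightarrow> bool" where
  "weakly_majorizes \<delta> \<gamma> \<longleftrightarrow>
     sum_list \<gamma> \<le> sum_list \<delta> \<and>
     (\<forall>m \<le> min (length \<gamma>) (length \<delta>). sum_list (take m \<gamma>) \<le> sum_list (take m \<delta>))"

definition majorizes :: "nat list \<Rightarrow> nat list \<Rightarrow> bool" where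
  "majorizes \<delta> \<gamma> \<longleftrightarrow> weakly_majorizes \<delta> \<gamma> \<and> sum_list \<gamma> = sum_list \<delta>"

type_synonym block = "nat list \<times> nat list"

definition blocks :: "nat \<Rightarrow> nat \<Rightarrow> block set" where
  "blocks n\<^sub>1 n\<^sub>2 = {(\<alpha>, \<beta>). 0 < n\<^sub>1 \<and> n\<^sub>1 \<le> n\<^sub>2 \<and> even n\<^sub>1 = even n\<^sub>2 \<and>
     \<alpha> \<in> Dis n\<^sub>1 \<and> \<beta> \<in> Dis n\<^sub>2 \<and> weakly_majorizes \<beta> \<alpha> \<and>
     length \<alpha> \<in> {length \<beta>, length \<beta> + 1}}"

definition is_block :: "block \<Rightarrow> bool" where
  "is_block b \<longleftrightarrow> (\<exists>n\<^sub>1 n\<^sub>2. b \<in> blocks n\<^sub>1 n\<^sub>2)"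

definition S_blocks :: "nat \<Rightarrow> block set" where
  "S_blocks n = blocks n n"

fun block_majorizes :: "block \<Rightarrow> block \<Rightarrow> bool" where
  "block_majorizes (\<alpha>\<^sub>1, \<beta>\<^sub>1) (\<alpha>\<^sub>2, \<beta>\<^sub>2) \<longleftrightarrow> majorizes \<alpha>\<^sub>1 \<alpha>\<^sub>2 \<and> majorizes \<beta>\<^sub>2 \<beta>\<^sub>1"

text \<open>A pair \<open>(x, y)\<close> in this relation means that \<open>x\<close> is below \<open>y\<close>.\<close>

definition majorization_order :: "block set \<Rightarrow> block rel" where
  "majorization_order P = {(x, y). x \<in> P \<and> y \<in> P \<and> block_majorizes y x}"

definition A_blocks :: "nat \<Rightarrow> nat \<Rightarrow> block set" where
  "A_blocks n k = S_blocks n \<inter> (Dis_len k n \<times> Dis_len k n)"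

text \<open>The set \<open>P'\<close> is an amphora in the poset \<open>(P, r)\<close>.\<close>

definition amphora_in :: "'a set \<Rightarrow> 'a rel \<Rightarrow> 'a set \<Rightarrow> bool" where
  "amphora_in P r P' \<longleftrightarrow> partial_order_on P r \<and>
     (\<exists>A x. A \<subseteq> P \<and> (\<forall>a\<in>A. \<forall>b\<in>A. (a, b) \<in> r \<longrightarrow> a = b) \<and>
            x \<in> P \<and> (\<forall>a\<in>A. (x, a) \<in> r) \<and>
            P' = {y \<in> P. (x, y) \<in> r \<and> (\<exists>a\<in>A. (y, a) \<in> r)})"


section \<open>Graphs\<close>

text \<open>A finite simple graph is a finite vertex set \<open>V\<close> with a set \<open>E\<close> of two-element subsets of \<open>V\<close>.\<close>

definition simple_graph :: "'a set \<Rightarrow> 'a set set \<Rightarrow> bool" where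
  "simple_graph V E \<longleftrightarrow> finite V \<and> E \<subseteq> nsets V 2"

definition degree :: "'a set set \<Rightarrow> 'a \<Rightarrow> nat" where
  "degree E v = card {e \<in> E. v \<in> e}"

definition no_isolated :: "'a set \<Rightarrow> 'a set set \<Rightarrow> bool" where
  "no_isolated V E \<longleftrightarrow> (\<forall>v\<in>V. \<exists>e\<in>E. v \<in> e)"

definition complement_edges :: "'a set \<Rightarrow> 'a set set \<Rightarrow> 'a set set" where
  "complement_edges V E = nsets V 2 - E"

definition colourable :: "'a set \<Rightarrow> 'a set set \<Rightarrow> nat \<Rightarrow> bool" where
  "colourable V E k \<longleftrightarrow>
     (\<exists>c. c ` V \<subseteq> {..<k} \<and> (\<forall>u\<in>V. \<forall>v\<in>V. {u, v} \<in> E \<longrightarrow> c u \<noteq> (c v :: nat)))"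

definition chromatic_number :: "'a set \<Rightarrow> 'a set set \<Rightarrow> nat" where
  "chromatic_number V E = (LEAST k. colourable V E k)"

definition induced_edges :: "'a set set \<Rightarrow> 'a set \<Rightarrow> 'a set set" where
  "induced_edges E W = {e \<in> E. e \<subseteq> W}"

definition is_5_cycle :: "'a set \<Rightarrow> 'a set set \<Rightarrow> bool" where
  "is_5_cycle V E \<longleftrightarrow>
     (\<exists>f :: nat \<Rightarrow> 'a. bij_betw f {..<5} V \<and> E = {{f i, f ((i + 1) mod 5)} | i. i < 5})"

definition NG_graph :: "'a set \<Rightarrow> 'a set set \<Rightarrow> bool" where
  "NG_graph V E \<longleftrightarrow> simple_graph V E \<and> no_isolated V E \<and>
     chromatic_number V E + chromatic_number V (complement_edges V E) = card V + 1"

text \<open>The equation \<open>degree v = \<chi> - 1\<close> is written without subtraction.\<close>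

definition A_set :: "'a set \<Rightarrow> 'a set set \<Rightarrow> 'a set" where
  "A_set V E = {v \<in> V. degree E v + 1 = chromatic_number V E}"

definition NG3_graph :: "'a set \<Rightarrow> 'a set set \<Rightarrow> bool" where
  "NG3_graph V E \<longleftrightarrow> NG_graph V E \<and> is_5_cycle (A_set V E) (induced_edges E (A_set V E))"

definition degree_sequence :: "'a set \<Rightarrow> 'a set set \<Rightarrow> nat list" where
  "degree_sequence V E = rev (sorted_list_of_multiset (image_mset (degree E) (mset_set V)))"

text \<open>
  The \<open>i\<close>-th degree, counting from \<open>1\<close>, is \<open>\<pi> ! (i - 1)\<close>. Along a decreasing \<open>\<pi>\<close> the indices
  selected by either filter form an initial segment, so the \<open>i\<close>-th part is in position \<open>i\<close>; and
  the number of degrees \<open>\<ge> j\<close> is at most \<open>length \<pi>\<close>, so no \<open>j > length \<pi>\<close> contributes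
  to \<open>\<beta>\<close>.
\<close>

definition alpha_part :: "nat list \<Rightarrow> nat list" where
  "alpha_part \<pi> = [\<pi> ! (i - 1) + 1 - i. i \<leftarrow> [1..<length \<pi> + 1], i \<le> \<pi> ! (i - 1)]"

definition beta_part :: "nat list \<Rightarrow> nat list" where
  "beta_part \<pi> =
     [length (filter (\<lambda>d. j \<le> d) \<pi>) - j.
        j \<leftarrow> [1..<length \<pi> + 1], j < length (filter (\<lambda>d. j \<le> d) \<pi>)]"

text \<open>Every finite graph is isomorphic to one whose vertices are natural numbers.\<close>

definition NG3_block :: "block \<Rightarrow> bool" where
  "NG3_block b \<longleftrightarrow> is_block b \<and>
     (\<exists>(V :: nat set) E. NG3_graph V E \<and>
        b = (alpha_part (degree_sequence V E), beta_part (degree_sequence V E)))"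

definition NG3_blocks :: "nat \<Rightarrow> nat \<Rightarrow> block set" where
  "NG3_blocks n k = {(\<alpha>, \<beta>). NG3_block (\<alpha>, \<beta>) \<and>
     (\<exists>\<alpha>' \<beta>'. \<alpha> = \<alpha>' @ [2, 1] \<and> \<beta> = \<beta>' @ [4, 3] \<and>
        \<alpha>' \<in> Dis_len k n \<and> \<beta>' \<in> Dis_len k n \<and>
        (\<forall>a\<in>set \<alpha>'. 3 \<le> a) \<and> (\<forall>b\<in>set \<beta>'. 5 \<le> b))}"

end

theory Submission
  imports Defs
begin

text \<open>
Write a partition with \<open>k\<close> distinct parts as a staircase \<open>k, \<dots>, 1\<close> plus a weakly decreasing
sequence of nonnegative integers. An element of \<open>A_blocks m k\<close> then is a pair \<open>(x, y)\<close> of such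
sequences with equal sums in which \<open>y\<close> dominates \<open>x\<close>. The bijection adds \<open>4\<close> to all parts of a
split block and appends \<open>2, 1\<close> to the first and \<open>4, 3\<close> to the second component
(\<open>raise_block\<close>). This visibly preserves and reflects majorization; the point is that its image is
exactly the set of NG-3 blocks in question.

That every raised split block is an NG-3 block (\<open>raise_block_NG3\<close>) is a realization problem. A
graph consisting of a \<open>k\<close>-clique, a 5-cycle joined to all of the clique, and an independent set
joined only to the clique is an NG-3 graph: its chromatic number is \<open>k + 3\<close>, and its complement
has the same shape with clique and independent set exchanged (locale \<open>pentagon_join\<close>). The
staircase, the shift by \<open>4\<close> and the four extra parts come from the clique and the pentagon, so what
is left is to find a bipartite graph with degrees \<open>x\<close> on one side and the conjugate of \<open>y\<close> on the
other. By the Gale--Ryser theorem dominance suffices: start with the Ferrers diagram of \<open>y\<close> and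
transfer single points (\<open>set_family_of_majorized_sizes\<close>).

Conversely (\<open>NG3_block_is_raised\<close>), removing the extra parts leaves components \<open>a\<close> and \<open>b\<close> with
equal sums in which \<open>b\<close> majorizes \<open>a\<close>, hence the smallest part of \<open>a\<close> is at least the smallest
part of \<open>b\<close>, which is at least \<open>5\<close>. So \<open>4\<close> can be subtracted everywhere.

The poset \<open>A_blocks m k\<close> has a least element, given by the most even and the least even partition,
and each of its elements \<open>(a, b)\<close> lies below the diagonal element \<open>(a, a)\<close>; the diagonal elements
form an antichain. Inside all split blocks nothing else lies between, since comparability bounds
the number of parts (\<open>S_block_between_same_length\<close>). The bijection carries the amphora to the
poset of NG-3 blocks.
\<close>

section \<open>Majorization as a partial order\<close>

lemma sum_list_take_nth:
  fixes xs :: "nat list"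
  assumes "m \<le> length xs"
  shows "sum_list (take m xs) = (\<Sum>i<m. xs ! i)"
  using assms by (simp add: sum_list_sum_nth atLeast0LessThan)

lemma majorizes_same_length:
  assumes "length a = length b"
  shows "majorizes a b \<longleftrightarrow>
    sum_list b = sum_list a \<and> (\<forall>m\<le>length a. sum_list (take m b) \<le> sum_list (take m a))"
  using assms by (auto simp: majorizes_def weakly_majorizes_def)

text \<open>
This is what makes comparison of prefix sums up to the shorter length well behaved: if \<open>a\<close> were
longer than \<open>b\<close>, a proper prefix of \<open>a\<close> would already reach the common total and the remaining
positive parts would exceed it. Transitivity and antisymmetry, as well as all later control over
the number of parts, rest on it.
\<close>

lemma majorizes_length:
  assumes maj: "majorizes a b" and pos: "\<forall>x\<in>set a. 0 < x"
  shows "length a \<le> length b"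
proof (rule ccontr)
  assume "\<not> length a \<le> length b"
  hence lt: "length b < length a" by simp
  have "sum_list (take (length b) b) \<le> sum_list (take (length b) a)"
    using maj lt unfolding majorizes_def weakly_majorizes_def by (metis min.absorb3 order_refl)
  moreover have "sum_list a = sum_list (take (length b) a) + sum_list (drop (length b) a)"
    by (metis append_take_drop_id sum_list_append)
  moreover have "0 < sum_list (drop (length b) a)"
    using pos lt by (simp add: Cons_nth_drop_Suc[symmetric])
  ultimately show False using maj by (simp add: majorizes_def)
qed

lemma majorizes_refl: "majorizes a a"
  by (simp add: majorizes_def weakly_majorizes_def)

lemma majorizes_trans:
  assumes "majorizes a b" "majorizes b c" "\<forall>x\<in>set a. 0 < x" "\<forall>x\<in>set b. 0 < x"
  shows "majorizes a c"
proof -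
  have "length a \<le> length b" "length b \<le> length c"
    using assms majorizes_length by blast+
  thus ?thesis using assms(1,2)
    by (auto simp: majorizes_def weakly_majorizes_def intro: order_trans)
qed

lemma majorizes_antisym:
  assumes "majorizes a b" "majorizes b a" "\<forall>x\<in>set a. 0 < x" "\<forall>x\<in>set b. 0 < x"
  shows "a = b"
proof (rule nth_equalityI)
  show len: "length a = length b"
    using assms majorizes_length by (metis le_antisym)
  have pre: "sum_list (take m a) = sum_list (take m b)" if "m \<le> length a" for m
    using assms(1,2) that len by (simp add: majorizes_same_length le_antisym)
  fix i assume i: "i < length a"
  have "sum_list (take (Suc i) a) = sum_list (take i a) + a ! i"
    "sum_list (take (Suc i) b) = sum_list (take i b) + b ! i"
    using i len by (simp_all add: take_Suc_conv_app_nth)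
  thus "a ! i = b ! i" using pre[of i] pre[of "Suc i"] i by simp
qed

lemma partial_order_majorization:
  assumes pos: "\<And>a b. (a, b) \<in> P \<Longrightarrow> (\<forall>x\<in>set a. 0 < x) \<and> (\<forall>x\<in>set b. 0 < x)"
  shows "partial_order_on P (majorization_order P)"
proof -
  have "trans (majorization_order P)"
  proof (rule transI)
    fix x y z assume "(x, y) \<in> majorization_order P" "(y, z) \<in> majorization_order P"
    thus "(x, z) \<in> majorization_order P"
      by (cases x; cases y; cases z)
        (auto simp: majorization_order_def dest!: pos intro: majorizes_trans)
  qed
  moreover have "antisym (majorization_order P)"
  proof (rule antisymI)
    fix x y assume "(x, y) \<in> majorization_order P" "(y, x) \<in> majorization_order P"
    thus "x = y"
      by (cases x; cases y)
        (auto simp: majorization_order_def dest!: pos intro: majorizes_antisym)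
  qed
  moreover have "refl_on P (majorization_order P)"
    by (auto simp: refl_on_def majorization_order_def majorizes_refl)
  ultimately show ?thesis
    by (auto simp: partial_order_on_def preorder_on_def majorization_order_def)
qed


section \<open>Removing a staircase\<close>

text \<open>
Subtracting \<open>k, k - 1, \<dots>, 1\<close> turns partitions into \<open>k\<close> distinct positive parts into weakly
decreasing sequences of \<open>k\<close> nonnegative integers. The staircase contributes equally to both
sides of every prefix inequality, so this identification respects majorization.
\<close>

definition add_staircase :: "nat \<Rightarrow> (nat \<Rightarrow> nat) \<Rightarrow> nat list" where
  "add_staircase k x = map (\<lambda>i. x i + (k - i)) [0..<k]"

lemma length_add_staircase [simp]: "length (add_staircase k x) = k"
  by (simp add: add_staircase_def)

lemma nth_add_staircase [simp]: "i < k \<Longrightarrow> add_staircase k x ! i = x i + (k - i)"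
  by (simp add: add_staircase_def)

lemma sum_staircase: "(\<Sum>i<k. k - i) = (k + 1 choose 2)"
proof (induction k)
  case (Suc k)
  have "(\<Sum>i<Suc k. Suc k - i) = Suc k + (\<Sum>i<k. k - i)"
    by (simp only: sum.lessThan_Suc_shift) simp
  also have "\<dots> = (Suc k + 1 choose 2)"
    using Suc by (simp add: numeral_2_eq_2)
  finally show ?case .
qed simp

lemma sum_take_add_staircase:
  "m \<le> k \<Longrightarrow> sum_list (take m (add_staircase k x)) = (\<Sum>i<m. x i) + (\<Sum>i<m. k - i)"
  by (simp only: sum_list_take_nth length_add_staircase sum.distrib[symmetric]) simp

lemma sum_add_staircase: "sum_list (add_staircase k x) = (\<Sum>i<k. x i) + (k + 1 choose 2)"
  using sum_take_add_staircase[of k k x] by (simp add: sum_staircase)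

lemma add_staircase_in_Dis:
  assumes "antimono_on {..<k} x" and "(\<Sum>i<k. x i) + (k + 1 choose 2) = n"
  shows "add_staircase k x \<in> Dis_len k n"
proof -
  have "sorted_wrt (>) (add_staircase k x)"
    unfolding sorted_wrt_iff_nth_less
  proof (intro allI impI)
    fix i j assume "i < j" "j < length (add_staircase k x)"
    moreover from this have "x j \<le> x i"
      using assms(1) by (auto simp: monotone_on_def)
    ultimately show "add_staircase k x ! j < add_staircase k x ! i" by simp
  qed
  moreover have "\<forall>y\<in>set (add_staircase k x). 0 < y"
    by (auto simp: add_staircase_def)
  ultimately show ?thesis
    using assms(2) by (simp add: Dis_len_def Dis_def sum_add_staircase)
qed

lemma Dis_nth_gap:
  assumes a: "a \<in> Dis_len k n" and "i \<le> j" "j < k"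
  shows "a ! j + (j - i) \<le> a ! i"
  using assms(2,3)
proof (induction j rule: dec_induct)
  case (step j)
  have "a ! Suc j < a ! j"
    using a step by (auto simp: Dis_len_def Dis_def sorted_wrt_iff_nth_less)
  thus ?case using step by simp
qed simp

lemma Dis_len_add_staircase:
  assumes a: "a \<in> Dis_len k n"
  obtains x where "antimono_on {..<k} x" "a = add_staircase k x"
    "(\<Sum>i<k. x i) + (k + 1 choose 2) = n"
proof -
  define x where "x = (\<lambda>i. a ! i - (k - i))"
  have len: "length a = k" using a by (simp add: Dis_len_def)
  have large: "k - i \<le> a ! i" if "i < k" for i
  proof -
    have "0 < a ! (k - 1)" using a that by (auto simp: Dis_len_def Dis_def)
    moreover have "a ! (k - 1) + (k - 1 - i) \<le> a ! i"
      using that by (intro Dis_nth_gap[OF a]) auto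
    ultimately show ?thesis by simp
  qed
  have eq: "a = add_staircase k x"
  proof (rule nth_equalityI)
    show "a ! i = add_staircase k x ! i" if "i < length a" for i
      using large[of i] that len by (simp add: x_def)
  qed (simp add: len)
  moreover have "antimono_on {..<k} x"
  proof (rule monotone_onI)
    fix i j assume "i \<in> {..<k}" "j \<in> {..<k}" "i \<le> j"
    thus "x j \<le> x i" using Dis_nth_gap[OF a, of i j] large[of i] large[of j]
      by (simp add: x_def)
  qed
  moreover have "(\<Sum>i<k. x i) + (k + 1 choose 2) = n"
    using a sum_add_staircase[of k x] eq by (simp add: Dis_len_def Dis_def)
  ultimately show thesis using that by blast
qed

lemma majorizes_add_staircase:
  "majorizes (add_staircase k x) (add_staircase k y) \<longleftrightarrow>
    (\<Sum>i<k. y i) = (\<Sum>i<k. x i) \<and> (\<forall>m\<le>k. (\<Sum>i<m. y i) \<le> (\<Sum>i<m. x i))"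
  by (simp add: majorizes_same_length sum_add_staircase sum_take_add_staircase)

text \<open>
If a prefix sum of \<open>z\<close> fell below that of \<open>x\<close>, then \<open>z\<close> would be smaller than \<open>x\<close> somewhere
in the prefix and larger somewhere behind it; since \<open>z\<close> decreases, this forces two entries of \<open>x\<close>
to differ by at least two.
\<close>

lemma balanced_prefix_sums_least:
  fixes x z :: "nat \<Rightarrow> nat"
  assumes bal: "\<And>i j. i < k \<Longrightarrow> j < k \<Longrightarrow> x i \<le> x j + 1"
    and anti: "antimono_on {..<k} z" and eq: "(\<Sum>i<k. x i) = (\<Sum>i<k. z i)" and "m \<le> k"
  shows "(\<Sum>i<m. x i) \<le> (\<Sum>i<m. z i)"
proof (rule ccontr)
  assume less: "\<not> ?thesis"
  obtain i where i: "i < m" "z i < x i"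
    using less sum_mono[of "{..<m}" x z] by (meson lessThan_iff not_le)
  have split: "sum f {..<k} = sum f {..<m} + sum f {m..<k}" for f :: "nat \<Rightarrow> nat"
    using \<open>m \<le> k\<close> by (simp add: atLeast0LessThan[symmetric] sum.atLeastLessThan_concat)
  have "sum x {m..<k} < sum z {m..<k}"
    using less eq split[of x] split[of z] by simp
  then obtain j where j: "m \<le> j" "j < k" "x j < z j"
    using sum_mono[of "{m..<k}" z x] by (meson atLeastLessThan_iff not_le)
  have "z j \<le> z i" using anti i j by (auto simp: monotone_on_def)
  thus False using bal[of i j] i j by simp
qed

text \<open>
The excess over the staircase is spread as evenly as possible.
\<close>

lemma Dis_len_least:
  assumes "0 < k" and "(k + 1 choose 2) \<le> n"
  obtains a where "a \<in> Dis_len k n" "\<And>b. b \<in> Dis_len k n \<Longrightarrow> majorizes b a"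
proof -
  define s where "s = n - (k + 1 choose 2)"
  define x where "x i = s div k + (if i < s mod k then 1 else 0)" for i
  have "(\<Sum>i<k. if i < s mod k then 1 else (0::nat)) = card {i. i < k \<and> i < s mod k}"
    by (simp add: sum.If_cases Int_def)
  also have "{i. i < k \<and> i < s mod k} = {..<s mod k}"
    using assms(1) by (auto intro: less_trans)
  finally have sum: "(\<Sum>i<k. x i) = s"
    by (simp add: x_def sum.distrib)
  have anti: "antimono_on {..<k} x" by (auto simp: x_def monotone_on_def)
  show thesis
  proof
    show "add_staircase k x \<in> Dis_len k n"
      using anti sum assms(2) by (intro add_staircase_in_Dis) (auto simp: s_def)
    fix b assume "b \<in> Dis_len k n"
    then obtain z where z: "antimono_on {..<k} z" "b = add_staircase k z"
      "(\<Sum>i<k. z i) + (k + 1 choose 2) = n" by (rule Dis_len_add_staircase)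
    have "(\<Sum>i<k. x i) = (\<Sum>i<k. z i)" using sum z(3) by (simp add: s_def)
    thus "majorizes b (add_staircase k x)"
      using balanced_prefix_sums_least[of k x z] z
      by (auto simp: majorizes_add_staircase x_def)
  qed
qed

text \<open>
The whole excess over the staircase is put into the first part.
\<close>

lemma Dis_len_greatest:
  assumes "0 < k" and "(k + 1 choose 2) \<le> n"
  obtains a where "a \<in> Dis_len k n" "\<And>b. b \<in> Dis_len k n \<Longrightarrow> majorizes a b"
proof -
  define s where "s = n - (k + 1 choose 2)"
  define x where "x i = (if i = 0 then s else 0)" for i :: nat
  have pre: "(\<Sum>i<m. x i) = (if m = 0 then 0 else s)" for m
    by (simp add: x_def sum.delta)
  have anti: "antimono_on {..<k} x" by (auto simp: x_def monotone_on_def)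
  show thesis
  proof
    show "add_staircase k x \<in> Dis_len k n"
      using anti pre assms by (intro add_staircase_in_Dis) (auto simp: s_def)
    fix b assume "b \<in> Dis_len k n"
    then obtain z where z: "b = add_staircase k z"
      "(\<Sum>i<k. z i) + (k + 1 choose 2) = n" by (rule Dis_len_add_staircase)
    have total: "(\<Sum>i<k. z i) = s" using z(2) by (simp add: s_def)
    have "(\<Sum>i<m. z i) \<le> s" if "m \<le> k" for m
      using sum_mono2[of "{..<k}" "{..<m}" z] that total by simp
    thus "majorizes (add_staircase k x) b"
      using assms(1) total z by (auto simp: majorizes_add_staircase pre)
  qed
qed


section \<open>Families of sets with prescribed sizes\<close>

lemma card_swap:
  assumes "finite S" "i \<in> S" "j \<notin> S"
  shows "card (insert j (S - {i})) = card S"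
  using assms by (metis Diff_iff card.remove card_insert_disjoint finite_Diff)

text \<open>
The existence half of the Gale--Ryser theorem: a family of sets can be changed so that its sizes
become any majorized decreasing sequence while each point keeps the number of sets containing it.
A point is moved from a larger set to a smaller one, repeatedly. Let \<open>j\<close> be the first index whose
set is too small; the prefix inequality at \<open>j + 1\<close> gives an \<open>i < j\<close> whose set is too large, and
since \<open>x\<close> decreases, the set at \<open>i\<close> is larger than the one at \<open>j\<close> and has a point that the
latter misses. The sizes need not be decreasing at intermediate stages, which is why \<open>r\<close> is
arbitrary; the total surplus \<open>\<Sum>i<k. r i - x i\<close> (truncated subtraction) drops by one.
\<close>

lemma set_family_of_majorized_sizes:
  fixes x r :: "nat \<Rightarrow> nat" and M :: "nat \<Rightarrow> 'c set"
  assumes "antimono_on {..<k} x"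
    and "\<And>i. i < k \<Longrightarrow> finite (M i)" and "\<And>i. i < k \<Longrightarrow> card (M i) = r i"
    and "\<And>m. m \<le> k \<Longrightarrow> (\<Sum>i<m. x i) \<le> (\<Sum>i<m. r i)" and "(\<Sum>i<k. x i) = (\<Sum>i<k. r i)"
  shows "\<exists>N. (\<forall>i<k. finite (N i) \<and> card (N i) = x i) \<and>
    (\<forall>l. card {i. i < k \<and> l \<in> N i} = card {i. i < k \<and> l \<in> M i})"
  using assms(2-)
proof (induction "\<Sum>i<k. r i - x i" arbitrary: r M rule: less_induct)
  case (less r M)
  note fin = less.prems(1) and card_M = less.prems(2) and pre = less.prems(3) and tot = less.prems(4)
  show ?case
  proof (cases "\<forall>i<k. x i \<le> r i")
    case True
    have "r i = x i" if "i < k" for i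
      using True tot that sum_strict_mono_ex1[of "{..<k}" x r]
      by (metis finite_lessThan lessThan_iff nat_less_le)
    thus ?thesis using fin card_M by (intro exI[of _ M]) auto
  next
    case False
    define j where "j = (LEAST j. j < k \<and> r j < x j)"
    have j: "j < k" "r j < x j" and before: "\<And>i. i < j \<Longrightarrow> x i \<le> r i"
      using False LeastI_ex[of "\<lambda>j. j < k \<and> r j < x j"] not_less_Least[of _ "\<lambda>j. j < k \<and> r j < x j"]
      unfolding j_def[symmetric] by (auto simp: not_le not_less)
    have "\<exists>i<j. x i < r i"
    proof (rule ccontr)
      assume "\<not> ?thesis"
      hence "\<forall>i\<in>{..<j}. r i \<le> x i" by (meson lessThan_iff not_less)
      hence "(\<Sum>i<j. r i) \<le> (\<Sum>i<j. x i)" by (intro sum_mono) blast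
      thus False using pre[of "Suc j"] j by simp
    qed
    then obtain i where i: "i < j" "x i < r i" by blast
    have "x j \<le> x i" using assms(1) i j by (auto simp: monotone_on_def)
    hence "card (M j) < card (M i)" using card_M i j by simp
    then obtain l where l: "l \<in> M i" "l \<notin> M j"
      using card_mono[OF fin[OF j(1)], of "M i"] by (auto simp: not_le[symmetric])
    define N where "N = M(i := M i - {l}, j := insert l (M j))"
    define t where "t = r(i := r i - 1, j := r j + 1)"
    have ij: "i \<noteq> j" "i < k" using i j by auto
    \<comment> \<open>The transfer lowers exactly the prefix sums of length greater than \<open>i\<close> and at most \<open>j\<close>.\<close>
    have t_sum: "(\<Sum>p<m. t p) + (if i < m \<and> m \<le> j then 1 else 0) = (\<Sum>p<m. r p)" for m
    proof -
      have "(\<Sum>p<m. t p) + (if i < m then 1 else 0) = (\<Sum>p<m. r p) + (if j < m then 1 else 0)"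
      proof -
        have "t p + (if p = i then 1 else 0) = r p + (if p = j then 1 else 0)" for p
          using i by (simp add: t_def)
        hence "(\<Sum>p<m. t p + (if p = i then 1 else 0)) = (\<Sum>p<m. r p + (if p = j then 1 else 0))"
          by simp
        thus ?thesis by (simp add: sum.distrib)
      qed
      thus ?thesis using i by (cases "i < m"; cases "j < m") simp_all
    qed
    have "\<exists>N'. (\<forall>i<k. finite (N' i) \<and> card (N' i) = x i) \<and>
      (\<forall>l. card {i. i < k \<and> l \<in> N' i} = card {i. i < k \<and> l \<in> N i})"
    proof (rule less.hyps)
      show "(\<Sum>p<k. t p - x p) < (\<Sum>p<k. r p - x p)"
      proof (rule sum_strict_mono_ex1)
        show "\<forall>p\<in>{..<k}. t p - x p \<le> r p - x p"
          using i j by (auto simp: t_def)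
        show "\<exists>p\<in>{..<k}. t p - x p < r p - x p"
          using i ij by (intro bexI[of _ i]) (auto simp: t_def)
      qed simp
      show "finite (N p)" if "p < k" for p
        using fin that ij j by (auto simp: N_def)
      show "card (N p) = t p" if "p < k" for p
        using fin card_M that ij j l by (auto simp: N_def t_def)
      show "(\<Sum>p<k. x p) = (\<Sum>p<k. t p)"
        using t_sum[of k] tot j by simp
      show "(\<Sum>p<m. x p) \<le> (\<Sum>p<m. t p)" if "m \<le> k" for m
      proof (cases "i < m \<and> m \<le> j")
        case True
        \<comment> \<open>No entry before \<open>j\<close> is too small and entry \<open>i\<close> is too large, so the inequality has room for the loss of one.\<close>
        have "(\<Sum>p<m. x p) < (\<Sum>p<m. r p)"
          using True i before by (intro sum_strict_mono_ex1) auto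
        thus ?thesis using t_sum[of m] True by simp
      next
        case False
        thus ?thesis using t_sum[of m] pre[OF that] by auto
      qed
    qed
    moreover have "card {p. p < k \<and> c \<in> N p} = card {p. p < k \<and> c \<in> M p}" for c
    proof (cases "c = l")
      case True
      have "{p. p < k \<and> c \<in> N p} = insert j ({p. p < k \<and> c \<in> M p} - {i})"
        using True l ij j by (auto simp: N_def)
      moreover have "i \<in> {p. p < k \<and> c \<in> M p}" "j \<notin> {p. p < k \<and> c \<in> M p}"
        using True l ij by simp_all
      ultimately show ?thesis
        using card_swap[of "{p. p < k \<and> c \<in> M p}" i j] by simp
    next
      case False
      hence "c \<in> N p \<longleftrightarrow> c \<in> M p" for p
        using ij by (simp add: N_def)
      thus ?thesis by (simp only:)
    qed
    ultimately show ?thesis by (simp only:)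
  qed
qed


section \<open>Joining a clique to a pentagon\<close>

text \<open>
The shape of an NG-3 graph: a clique \<open>K\<close>, an independent set \<open>I\<close> and a 5-cycle, given by its
vertices in cyclic order, that is completely joined to \<open>K\<close> and not at all to \<open>I\<close>; the edges
between \<open>K\<close> and \<open>I\<close> are arbitrary. The five vertices are listed individually because the chords
of a pentagon form a pentagon again, so that the complement is an instance of the same locale.
\<close>

locale pentagon_join =
  fixes K I :: "'a set" and a0 a1 a2 a3 a4 :: 'a and E :: "'a set set"
  assumes finite_K: "finite K" and finite_I: "finite I"
    and disjoint: "K \<inter> I = {}" "{a0, a1, a2, a3, a4} \<inter> (K \<union> I) = {}"
    and distinct: "distinct [a0, a1, a2, a3, a4]"
    and edges: "E \<subseteq> nsets (K \<union> {a0, a1, a2, a3, a4} \<union> I) 2"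
    and clique: "\<And>u v. u \<in> K \<Longrightarrow> v \<in> K \<union> {a0, a1, a2, a3, a4} \<Longrightarrow> u \<noteq> v \<Longrightarrow> {u, v} \<in> E"
    and independent: "\<And>u v. u \<in> I \<Longrightarrow> v \<in> I \<union> {a0, a1, a2, a3, a4} \<Longrightarrow> {u, v} \<notin> E"
    and sides: "{a0, a1} \<in> E" "{a1, a2} \<in> E" "{a2, a3} \<in> E" "{a3, a4} \<in> E" "{a4, a0} \<in> E"
    and chords: "{a0, a2} \<notin> E" "{a1, a3} \<notin> E" "{a2, a4} \<notin> E" "{a3, a0} \<notin> E" "{a4, a1} \<notin> E"
begin

abbreviation P :: "'a set" where "P \<equiv> {a0, a1, a2, a3, a4}"
abbreviation V :: "'a set" where "V \<equiv> K \<union> P \<union> I"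

lemma no_loop: "{u} \<notin> E"
  using edges by (auto simp: nsets_def)

lemma independent': "u \<in> I \<Longrightarrow> v \<in> I \<union> P \<Longrightarrow> {v, u} \<notin> E"
  using independent by (metis insert_commute)

lemma clique': "u \<in> K \<Longrightarrow> v \<in> K \<union> P \<Longrightarrow> u \<noteq> v \<Longrightarrow> {v, u} \<in> E"
  using clique by (metis insert_commute)

lemma sides_sym: "{a1, a0} \<in> E" "{a2, a1} \<in> E" "{a3, a2} \<in> E" "{a4, a3} \<in> E" "{a0, a4} \<in> E"
  using sides by (simp_all only: insert_commute)

lemma chords_sym: "{a2, a0} \<notin> E" "{a3, a1} \<notin> E" "{a4, a2} \<notin> E" "{a0, a3} \<notin> E" "{a1, a4} \<notin> E"
  using chords by (simp_all add: insert_commute)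

lemmas sides' = sides sides_sym
lemmas chords' = chords chords_sym

lemma card_pentagon: "card P = 5"
  using distinct by simp

lemma card_V: "card V = card K + 5 + card I"
proof -
  have "card V = card (K \<union> P) + card I"
    using finite_K finite_I disjoint by (intro card_Un_disjoint) auto
  also have "card (K \<union> P) = card K + card P"
    using finite_K disjoint by (intro card_Un_disjoint) auto
  finally show ?thesis by (simp only: card_pentagon)
qed

text \<open>
Complementation exchanges \<open>K\<close> and \<open>I\<close> and reads the chords as sides, so facts proved for all
instances of the locale apply to the complement.
\<close>

lemma complement: "pentagon_join I K a0 a2 a4 a1 a3 (complement_edges V E)"
proof -
  have *: "{u, v} \<in> complement_edges V E \<longleftrightarrow> u \<in> V \<and> v \<in> V \<and> u \<noteq> v \<and> {u, v} \<notin> E" for u v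
    by (auto simp: complement_edges_def nsets_def card_insert_if)
  have V: "I \<union> {a0, a2, a4, a1, a3} \<union> K = V" by auto
  show ?thesis
  proof
    show "complement_edges V E \<subseteq> nsets (I \<union> {a0, a2, a4, a1, a3} \<union> K) 2"
      by (simp only: V) (auto simp: complement_edges_def)
  next
    fix u v assume uv: "u \<in> I" "v \<in> I \<union> {a0, a2, a4, a1, a3}" "u \<noteq> v"
    hence "v \<in> I \<union> P" by blast
    with uv(1,3) show "{u, v} \<in> complement_edges V E"
      unfolding * using independent[of u v] by blast
  next
    fix u v assume uv: "u \<in> K" "v \<in> K \<union> {a0, a2, a4, a1, a3}"
    hence "v \<in> K \<union> P" by blast
    with uv(1) show "{u, v} \<notin> complement_edges V E"
      unfolding * using clique[of u v] by blast
  qed (insert finite_K finite_I disjoint distinct sides' chords', unfold *, (simp; blast)+)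
qed

text \<open>
Three further colours suffice for the pentagon, and any of them may be used on \<open>I\<close>, which sends
no edge to the pentagon.
\<close>

lemma colourable: "colourable V E (card K + 3)"
proof -
  obtain g where g: "bij_betw g K {0..<card K}"
    using ex_bij_betw_finite_nat[OF finite_K] by blast
  define c where "c v = (if v \<in> K then g v else
    card K + (if v \<in> {a1, a3} then 1 else if v = a4 then 2 else 0))" for v
  have gK: "g v < card K" if "v \<in> K" for v
    using g that by (auto simp: bij_betw_def)
  have "c ` V \<subseteq> {..<card K + 3}"
    using gK by (auto simp: c_def less_imp_le trans_less_add1)
  moreover have "c u \<noteq> c v" if uv: "u \<in> V" "v \<in> V" "{u, v} \<in> E" for u v
  proof -
    have "u \<noteq> v" using uv(3) no_loop by auto
    consider "u \<in> K" "v \<in> K" | "u \<in> K" "v \<notin> K" | "u \<notin> K" "v \<in> K" | "u \<notin> K" "v \<notin> K" by blast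
    thus ?thesis
    proof cases
      case 1
      thus ?thesis using g \<open>u \<noteq> v\<close> by (auto simp: c_def bij_betw_def inj_on_def)
    next
      case 2
      thus ?thesis using gK[of u] by (auto simp: c_def)
    next
      case 3
      thus ?thesis using gK[of v] by (auto simp: c_def)
    next
      case 4
      hence "u \<in> P" "v \<in> P" using uv independent[of u v] independent'[of v u] by blast+
      moreover have "c a0 = card K" "c a1 = card K + 1" "c a2 = card K" "c a3 = card K + 1"
        "c a4 = card K + 2"
        using disjoint distinct by (auto simp: c_def)
      ultimately show ?thesis using uv(3) chords' \<open>u \<noteq> v\<close> by auto
    qed
  qed
  ultimately show ?thesis unfolding colourable_def by blast
qed

text \<open>
The clique uses pairwise different colours, none of which can occur on the pentagon, and an odd
cycle is not 2-colourable.
\<close>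

lemma colours_ge:
  assumes "colourable V E m"
  shows "card K + 3 \<le> m"
proof -
  obtain c where c: "c ` V \<subseteq> {..<m}" "\<And>u v. u \<in> V \<Longrightarrow> v \<in> V \<Longrightarrow> {u, v} \<in> E \<Longrightarrow> c u \<noteq> c v"
    using assms unfolding colourable_def by blast
  have inj: "inj_on c K"
  proof (rule inj_onI, rule ccontr)
    fix u v assume "u \<in> K" "v \<in> K" "c u = c v" "u \<noteq> v"
    thus False using c(2)[of u v] clique[of u v] by blast
  qed
  have "c ` K \<inter> c ` P = {}"
  proof -
    have "c u \<noteq> c v" if "u \<in> K" "v \<in> P" for u v
      using that disjoint(2) c(2)[of u v] clique[of u v] by blast
    thus ?thesis by blast
  qed
  moreover have "3 \<le> card (c ` P)"
  proof -
    have ne: "c a0 \<noteq> c a1" "c a1 \<noteq> c a2" "c a2 \<noteq> c a3" "c a3 \<noteq> c a4" "c a4 \<noteq> c a0"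
      by (rule c(2); use sides in simp)+
    have three: "3 \<le> card (c ` P)"
      if "p \<in> c ` P" "q \<in> c ` P" "r \<in> c ` P" "p \<noteq> q" "q \<noteq> r" "p \<noteq> r" for p q r
    proof -
      have "card {p, q, r} = 3" using that by simp
      moreover have "{p, q, r} \<subseteq> c ` P" using that by blast
      ultimately show ?thesis by (metis card_mono finite.emptyI finite.insertI finite_imageI)
    qed
    show ?thesis
    proof (cases "c a3 = c a1")
      case False
      thus ?thesis using ne by (intro three[of "c a1" "c a2" "c a3"]) auto
    next
      case True
      thus ?thesis using ne by (intro three[of "c a0" "c a1" "c a4"]) auto
    qed
  qed
  moreover have "c ` K \<union> c ` P \<subseteq> {..<m}" using c(1) by blast
  hence "card (c ` K \<union> c ` P) \<le> m" using card_mono[of "{..<m}"] by (metis card_lessThan finite_lessThan)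
  moreover have "card (c ` K) = card K" using inj by (rule card_image)
  moreover have "finite (c ` K)" "finite (c ` P)" using finite_K by auto
  ultimately show ?thesis using card_Un_disjoint[of "c ` K" "c ` P"] by linarith
qed

lemma chromatic_number_eq: "chromatic_number V E = card K + 3"
  unfolding chromatic_number_def using colourable colours_ge by (rule Least_equality)

lemma degree_neighbours:
  "degree E v = card {w \<in> V. {v, w} \<in> E}"
proof -
  have "bij_betw (\<lambda>w. {v, w}) {w \<in> V. {v, w} \<in> E} {e \<in> E. v \<in> e}"
  proof (rule bij_betw_imageI)
    show "inj_on (\<lambda>w. {v, w}) {w \<in> V. {v, w} \<in> E}"
      by (auto simp: inj_on_def doubleton_eq_iff)
    show "(\<lambda>w. {v, w}) ` {w \<in> V. {v, w} \<in> E} = {e \<in> E. v \<in> e}"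
    proof (intro equalityI subsetI)
      fix e assume e: "e \<in> {e \<in> E. v \<in> e}"
      hence "e \<subseteq> V" "card e = 2" using edges by (auto simp: nsets_def)
      then obtain w where "e = {v, w}" using e by (auto simp: card_2_iff)
      thus "e \<in> (\<lambda>w. {v, w}) ` {w \<in> V. {v, w} \<in> E}" using e \<open>e \<subseteq> V\<close> by blast
    qed auto
  qed
  thus ?thesis by (simp add: degree_def bij_betw_same_card)
qed

lemma degree_clique:
  assumes "u \<in> K"
  shows "degree E u = card K + 4 + card {v \<in> I. {u, v} \<in> E}"
proof -
  have "{u, w} \<in> E \<longleftrightarrow> w \<noteq> u" if "w \<in> K \<union> P" for w
    using clique[OF assms that] no_loop[of u] by (cases "w = u") simp_all
  moreover have "u \<notin> P" using assms disjoint(2) by blast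
  ultimately have "{w \<in> V. {u, w} \<in> E} = (K - {u}) \<union> P \<union> {v \<in> I. {u, v} \<in> E}"
    by blast
  moreover have "card \<dots> = card ((K - {u}) \<union> P) + card {v \<in> I. {u, v} \<in> E}"
    using finite_K finite_I disjoint by (intro card_Un_disjoint) auto
  moreover have "card ((K - {u}) \<union> P) = card (K - {u}) + card P"
    using finite_K disjoint by (intro card_Un_disjoint) auto
  moreover have "card K = Suc (card (K - {u}))"
    using finite_K assms by (rule card.remove)
  ultimately show ?thesis using card_pentagon by (simp only: degree_neighbours)
qed

lemma degree_pentagon:
  assumes "p \<in> P"
  shows "degree E p = card K + 2"
proof -
  have two: "card {w \<in> P. {p, w} \<in> E} = 2"
  proof -
    have filter_insert: "{w \<in> insert x X. Q w} =
      (if Q x then insert x {w \<in> X. Q w} else {w \<in> X. Q w})" for x :: 'a and X Q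
      by auto
    have "{w \<in> P. {a0, w} \<in> E} = {a1, a4}" "{w \<in> P. {a1, w} \<in> E} = {a0, a2}"
      "{w \<in> P. {a2, w} \<in> E} = {a1, a3}" "{w \<in> P. {a3, w} \<in> E} = {a2, a4}"
      "{w \<in> P. {a4, w} \<in> E} = {a0, a3}"
      using sides' chords' no_loop by (simp_all add: filter_insert del: insert_iff)
    moreover have "p = a0 \<or> p = a1 \<or> p = a2 \<or> p = a3 \<or> p = a4"
      using assms by blast
    ultimately show ?thesis
      using distinct by (elim disjE) simp_all
  qed
  have "{w \<in> V. {p, w} \<in> E} = K \<union> {w \<in> P. {p, w} \<in> E}"
    using assms independent' clique' disjoint(2) by blast
  moreover have "card \<dots> = card K + card {w \<in> P. {p, w} \<in> E}"
    using finite_K disjoint by (intro card_Un_disjoint) auto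
  ultimately show ?thesis using two by (simp only: degree_neighbours)
qed

lemma degree_independent:
  assumes "v \<in> I"
  shows "degree E v = card {u \<in> K. {u, v} \<in> E}"
proof -
  have "{w \<in> V. {v, w} \<in> E} = {u \<in> K. {u, v} \<in> E}"
    using assms independent[OF assms] by (auto simp: insert_commute[of v])
  thus ?thesis by (simp only: degree_neighbours)
qed

text \<open>
The chromatic number is \<open>card K + 3\<close>; the pentagon has degree \<open>card K + 2\<close>, while clique vertices
have degree at least \<open>card K + 4\<close> and independent ones at most \<open>card K\<close>.
\<close>

lemma A_set_eq: "A_set V E = P"
proof -
  have "degree E v + 1 = card K + 3 \<longleftrightarrow> v \<in> P" if v: "v \<in> V" for v
  proof -
    consider "v \<in> K" | "v \<in> P" | "v \<in> I" using v by blast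
    thus ?thesis
    proof cases
      case 1
      thus ?thesis using degree_clique disjoint(2) by auto
    next
      case 2
      thus ?thesis using degree_pentagon by simp
    next
      case 3
      have "card {u \<in> K. {u, v} \<in> E} \<le> card K" using finite_K by (intro card_mono) auto
      moreover have "v \<notin> P" using 3 disjoint(2) by blast
      ultimately show ?thesis using degree_independent[OF 3] by simp
    qed
  qed
  thus ?thesis unfolding A_set_def chromatic_number_eq by blast
qed

lemma is_5_cycle_pentagon: "is_5_cycle P (induced_edges E P)"
proof -
  define f where "f = (!) [a0, a1, a2, a3, a4]"
  have five: "{..<5::nat} = {0, 1, 2, 3, 4}" by auto
  have "{{f i, f ((i + 1) mod 5)} | i. i < 5} = (\<lambda>i. {f i, f ((i + 1) mod 5)}) ` {..<5}"
    by auto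
  also have "\<dots> = {{a0, a1}, {a1, a2}, {a2, a3}, {a3, a4}, {a4, a0}}"
    unfolding five by (simp add: f_def)
  also have "\<dots> = induced_edges E P"
  proof (intro equalityI subsetI)
    fix e assume "e \<in> induced_edges E P"
    hence e: "e \<in> E" "e \<subseteq> P" by (auto simp: induced_edges_def)
    then obtain u v where uv: "e = {u, v}" "u \<noteq> v"
      using edges by (auto simp: nsets_def card_2_iff)
    hence u: "u = a0 \<or> u = a1 \<or> u = a2 \<or> u = a3 \<or> u = a4"
      and v: "v = a0 \<or> v = a1 \<or> v = a2 \<or> v = a3 \<or> v = a4" using e by auto
    from u show "e \<in> {{a0, a1}, {a1, a2}, {a2, a3}, {a3, a4}, {a4, a0}}"
      by (elim disjE; insert v; elim disjE)
        (use uv e(1) chords' in \<open>simp_all add: doubleton_eq_iff\<close>)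
  qed (use sides in \<open>auto simp: induced_edges_def\<close>)
  finally have "induced_edges E P = {{f i, f ((i + 1) mod 5)} | i. i < 5}" by simp
  moreover have "bij_betw f {..<5} P"
  proof (rule bij_betw_imageI)
    show "inj_on f {..<5}" "f ` {..<5} = P"
      unfolding five using distinct by (auto simp: f_def)
  qed
  ultimately show ?thesis unfolding is_5_cycle_def by blast
qed

text \<open>
The two chromatic numbers are \<open>card K + 3\<close> and, by passing to the complement, \<open>card I + 3\<close>;
their sum exceeds the number \<open>card K + 5 + card I\<close> of vertices by one.
\<close>

lemma NG3_graph_pentagon_join:
  assumes "\<And>v. v \<in> I \<Longrightarrow> \<exists>u\<in>K. {u, v} \<in> E"
  shows "NG3_graph V E"
proof -
  interpret co: pentagon_join I K a0 a2 a4 a1 a3 "complement_edges V E"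
    by (rule complement)
  have "co.V = V" by auto
  hence "chromatic_number V (complement_edges V E) = card I + 3"
    using co.chromatic_number_eq by simp
  moreover have "no_isolated V E"
    unfolding no_isolated_def
  proof
    fix v assume "v \<in> V"
    then consider "v \<in> K" | "v \<in> P" | "v \<in> I" by blast
    thus "\<exists>e\<in>E. v \<in> e"
    proof cases
      case 1
      hence "{v, a0} \<in> E" using clique disjoint(2) by auto
      thus ?thesis by blast
    next
      case 2
      thus ?thesis using sides by blast
    next
      case 3
      thus ?thesis using assms by blast
    qed
  qed
  moreover have "simple_graph V E"
    using finite_K finite_I edges by (simp add: simple_graph_def)
  ultimately have "NG_graph V E"
    using chromatic_number_eq card_V unfolding NG_graph_def by linarith
  thus ?thesis unfolding NG3_graph_def A_set_eq using is_5_cycle_pentagon by blast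
qed

end


section \<open>From degree sequences to blocks\<close>

lemma degree_sequence_eqI:
  assumes "sorted_wrt (\<ge>) ds" and "mset ds = image_mset (degree E) (mset_set V)"
  shows "degree_sequence V E = ds"
proof -
  have "sorted (rev ds)" using assms(1) by (simp add: sorted_wrt_rev)
  hence "sort ds = rev ds" by (intro properties_for_sort) simp_all
  thus ?thesis by (simp add: degree_sequence_def assms(2)[symmetric])
qed

text \<open>
The filters in both parts of a block select an initial segment of indices. This evaluates such a
comprehension once the length \<open>K\<close> of the segment is known.
\<close>

lemma comprehension_initial_segment:
  assumes "\<And>i. 1 \<le> i \<Longrightarrow> i \<le> N \<Longrightarrow> Q i \<longleftrightarrow> i \<le> K" and "K \<le> N"
  shows "concat (map (\<lambda>i. if Q i then [f i] else []) [1..<N + 1]) = map (\<lambda>i. f (Suc i)) [0..<K]"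
proof -
  let ?g = "\<lambda>i. if Q i then [f i] else []"
  have "[1..<N + 1] = [1..<K + 1] @ [K + 1..<N + 1]"
    using assms(2) upt_add_eq_append[of 1 "K + 1" "N - K"] by simp
  hence "concat (map ?g [1..<N + 1]) =
    concat (map ?g [1..<K + 1]) @ concat (map ?g [K + 1..<N + 1])"
    by (simp only: map_append concat_append)
  also have "map ?g [1..<K + 1] = map (\<lambda>i. [f i]) [1..<K + 1]"
    using assms by auto
  also have "concat (map ?g [K + 1..<N + 1]) = []"
    using assms by auto
  also have "concat (map (\<lambda>i. [f i]) [1..<K + 1]) @ [] = map f [1..<K + 1]"
    by (simp only: concat_map_singleton append_Nil2)
  also have "[1..<K + 1] = map Suc [0..<K]"
    by (simp add: map_Suc_upt)
  finally show ?thesis by (simp only: map_map comp_def)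
qed

text \<open>
In a decreasing degree sequence the clique comes first, then the five equal degrees \<open>k + 2\<close>, then
degrees at most \<open>k\<close>. The pentagon is cut by the diagonal after two of its entries, which produce
the parts \<open>2, 1\<close>.
\<close>

lemma alpha_part_pentagon_join:
  assumes "\<forall>c\<in>set cs. c \<le> k"
  shows "alpha_part (map (\<lambda>i. k + 4 + x i) [0..<k] @ replicate 5 (k + 2) @ cs) =
    map (\<lambda>t. t + 4) (add_staircase k x) @ [2, 1]" (is "alpha_part ?ds = _")
proof -
  have nth: "?ds ! i = (if i < k then k + 4 + x i else if i < k + 5 then k + 2 else cs ! (i - k - 5))"
    for i
    by (auto simp: nth_append)
  have small: "cs ! (i - k - 5) \<le> k" if "k + 5 \<le> i" "i < k + 5 + length cs" for i
    using assms that by simp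
  have "alpha_part ?ds = map (\<lambda>i. ?ds ! (Suc i - 1) + 1 - Suc i) [0..<k + 2]"
    unfolding alpha_part_def
  proof (rule comprehension_initial_segment)
    fix i assume i: "1 \<le> i" "i \<le> length ?ds"
    show "i \<le> ?ds ! (i - 1) \<longleftrightarrow> i \<le> k + 2"
      using i small[of "i - 1"] unfolding nth by (cases i) auto
  qed simp
  also have "\<dots> = map (\<lambda>i. k + 4 + x i + 1 - Suc i) [0..<k] @ [2, 1]"
    unfolding nth by auto
  also have "map (\<lambda>i. k + 4 + x i + 1 - Suc i) [0..<k] = map (\<lambda>t. t + 4) (add_staircase k x)"
    by (auto simp: add_staircase_def)
  finally show ?thesis .
qed

text \<open>
Dually, the columns \<open>k + 1\<close> and \<open>k + 2\<close> of the Ferrers diagram both have height \<open>k + 5\<close> and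
produce the parts \<open>4, 3\<close>. The numbers \<open>y i\<close> form the partition conjugate to the degrees \<open>cs\<close> of
the independent vertices.
\<close>

lemma beta_part_pentagon_join:
  assumes le: "\<forall>c\<in>set cs. c \<le> k"
    and conj: "\<And>i. i < k \<Longrightarrow> length (filter (\<lambda>c. Suc i \<le> c) cs) = y i"
  shows "beta_part (map (\<lambda>i. k + 4 + x i) [0..<k] @ replicate 5 (k + 2) @ cs) =
    map (\<lambda>t. t + 4) (add_staircase k y) @ [4, 3]" (is "beta_part ?ds = _")
proof -
  define F where "F j = length (filter (\<lambda>d. j \<le> d) ?ds)" for j
  have F: "F j = length (filter (\<lambda>i. j \<le> k + 4 + x i) [0..<k]) + (if j \<le> k + 2 then 5 else 0)
    + length (filter (\<lambda>c. j \<le> c) cs)" for j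
    by (simp add: F_def filter_map comp_def filter_replicate)
  have F1: "F (Suc i) = k + 5 + y i" if "i < k" for i
    using that by (simp add: F conj)
  have none: "filter (\<lambda>c. j \<le> c) cs = []" if "k < j" for j
    using le that by (auto simp: filter_empty_conv)
  have F2: "F j = k + 5" if "k < j" "j \<le> k + 2" for j
    using that by (simp add: F none)
  have F3: "F j \<le> k" if "k + 2 < j" for j
    using that length_filter_le[of "\<lambda>i. j \<le> k + 4 + x i" "[0..<k]"] by (simp add: F none)
  have "beta_part ?ds = map (\<lambda>i. F (Suc i) - Suc i) [0..<k + 2]"
    unfolding beta_part_def F_def[symmetric]
  proof (rule comprehension_initial_segment)
    fix j assume j: "1 \<le> j" "j \<le> length ?ds"
    show "j < F j \<longleftrightarrow> j \<le> k + 2"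
      using F1[of "j - 1"] F2[of j] F3[of j] j by (cases "j \<le> k"; cases "j \<le> k + 2") auto
  qed simp
  also have "\<dots> = map (\<lambda>i. F (Suc i) - Suc i) [0..<k] @ [4, 3]"
    by (simp add: F2)
  also have "map (\<lambda>i. F (Suc i) - Suc i) [0..<k] = map (\<lambda>t. t + 4) (add_staircase k y)"
    by (auto simp: add_staircase_def F1)
  finally show ?thesis .
qed


section \<open>Realizing a pair of partitions by a graph\<close>

text \<open>
The vertices below \<open>k\<close> form the clique, the next five the pentagon, and \<open>k + 5 + l\<close> is the
independent vertex corresponding to the point \<open>l\<close> of the family \<open>N\<close>: the clique vertex \<open>u\<close> is
joined to the points of \<open>N u\<close>.
\<close>

definition pentagon_edges :: "nat \<Rightarrow> (nat \<Rightarrow> nat set) \<Rightarrow> nat set set" where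
  "pentagon_edges k N = {{u, v} | u v. u < k \<and> v < k + 5 \<and> u \<noteq> v} \<union>
     {{k, k + 1}, {k + 1, k + 2}, {k + 2, k + 3}, {k + 3, k + 4}, {k + 4, k}} \<union>
     {{u, k + 5 + l} | u l. u < k \<and> l \<in> N u}"

lemma pentagon_edges_iff:
  assumes "u < v"
  shows "{u, v} \<in> pentagon_edges k N \<longleftrightarrow>
    u < k \<and> v < k + 5 \<or> u < k \<and> k + 5 \<le> v \<and> v - (k + 5) \<in> N u \<or>
    (u, v) \<in> {(k, k + 1), (k + 1, k + 2), (k + 2, k + 3), (k + 3, k + 4), (k, k + 4)}"
proof -
  have "{u, v} \<in> {{u, v} | u v. u < k \<and> v < k + 5 \<and> u \<noteq> v} \<longleftrightarrow> u < k \<and> v < k + 5"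
    using assms by (auto simp: doubleton_eq_iff)
  moreover have "{u, v} \<in> {{k, k + 1}, {k + 1, k + 2}, {k + 2, k + 3}, {k + 3, k + 4}, {k + 4, k}} \<longleftrightarrow>
    (u, v) \<in> {(k, k + 1), (k + 1, k + 2), (k + 2, k + 3), (k + 3, k + 4), (k, k + 4)}"
    using assms by (auto simp: doubleton_eq_iff)
  moreover have "{u, v} \<in> {{u, k + 5 + l} | u l. u < k \<and> l \<in> N u} \<longleftrightarrow>
    u < k \<and> k + 5 \<le> v \<and> v - (k + 5) \<in> N u"
  proof
    assume "u < k \<and> k + 5 \<le> v \<and> v - (k + 5) \<in> N u"
    thus "{u, v} \<in> {{u, k + 5 + l} | u l. u < k \<and> l \<in> N u}"
      by (intro CollectI exI[of _ u] exI[of _ "v - (k + 5)"]) simp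
  qed (use assms in \<open>auto simp: doubleton_eq_iff\<close>)
  ultimately show ?thesis unfolding pentagon_edges_def Un_iff by (simp only: disj_ac)
qed

lemma pentagon_join_pentagon_edges:
  assumes N: "\<And>i. i < k \<Longrightarrow> N i \<subseteq> {..<q}"
  shows "pentagon_join {..<k} {k + 5..<k + 5 + q} k (k + 1) (k + 2) (k + 3) (k + 4) (pentagon_edges k N)"
proof -
  let ?E = "pentagon_edges k N"
  have V: "{..<k} \<union> {k, k + 1, k + 2, k + 3, k + 4} \<union> {k + 5..<k + 5 + q} = {..<k + 5 + q}"
    by auto
  have loop: "{u} \<notin> ?E" for u
    by (auto simp: pentagon_edges_def)
  show ?thesis
  proof
    show "?E \<subseteq> nsets ({..<k} \<union> {k, k + 1, k + 2, k + 3, k + 4} \<union> {k + 5..<k + 5 + q}) 2"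
      unfolding V using N by (fastforce simp: pentagon_edges_def nsets_def card_insert_if)
  next
    fix u v assume "u \<in> {..<k}" "v \<in> {..<k} \<union> {k, k + 1, k + 2, k + 3, k + 4}" "u \<noteq> v"
    thus "{u, v} \<in> ?E"
      unfolding pentagon_edges_def by (intro UnI1 CollectI exI[of _ u] exI[of _ v]) auto
  next
    fix u v assume uv: "u \<in> {k + 5..<k + 5 + q}"
      "v \<in> {k + 5..<k + 5 + q} \<union> {k, k + 1, k + 2, k + 3, k + 4}"
    show "{u, v} \<notin> ?E"
    proof (cases u v rule: linorder_cases)
      case less
      thus ?thesis using uv by (auto simp: pentagon_edges_iff)
    next
      case equal
      thus ?thesis using loop by simp
    next
      case greater
      thus ?thesis using uv by (auto simp: insert_commute[of u v] pentagon_edges_iff)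
    qed
  next
    show "{k, k + 1} \<in> ?E" "{k + 1, k + 2} \<in> ?E" "{k + 2, k + 3} \<in> ?E" "{k + 3, k + 4} \<in> ?E"
      "{k + 4, k} \<in> ?E"
      unfolding pentagon_edges_def by blast+
    have "{k, k + 3} \<notin> ?E" "{k + 1, k + 4} \<notin> ?E"
      by (simp_all add: pentagon_edges_iff)
    thus "{k + 3, k} \<notin> ?E" "{k + 4, k + 1} \<notin> ?E"
      by (simp_all only: insert_commute not_False_eq_True)
    show "{k, k + 2} \<notin> ?E" "{k + 1, k + 3} \<notin> ?E" "{k + 2, k + 4} \<notin> ?E"
      by (simp_all add: pentagon_edges_iff)
  qed auto
qed

text \<open>
The bipartite part of the graph must have degrees \<open>x\<close> on the clique side and, on the independent
side, the partition \<open>c\<close> conjugate to \<open>y\<close>. The family \<open>{..<y i}\<close>, a Ferrers diagram, has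
the right independent degrees \<open>c\<close> but sizes \<open>y\<close>; as \<open>y\<close> dominates \<open>x\<close>, the sizes can be changed
to \<open>x\<close> without affecting \<open>c\<close>. Only the points below \<open>y 0\<close> are taken as vertices, so that none
is isolated. With this numbering the degrees decrease along the vertices, so their list is the
degree sequence.
\<close>

lemma NG3_graph_realization:
  assumes k: "0 < k" and x: "antimono_on {..<k} x" and y: "antimono_on {..<k} y"
    and le: "\<And>m. m \<le> k \<Longrightarrow> (\<Sum>i<m. x i) \<le> (\<Sum>i<m. y i)" and eq: "(\<Sum>i<k. x i) = (\<Sum>i<k. y i)"
  obtains V :: "nat set" and E where "NG3_graph V E"
    "alpha_part (degree_sequence V E) = map (\<lambda>t. t + 4) (add_staircase k x) @ [2, 1]"
    "beta_part (degree_sequence V E) = map (\<lambda>t. t + 4) (add_staircase k y) @ [4, 3]"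
proof -
  define c where "c l = card {i. i < k \<and> l < y i}" for l
  have "\<exists>N. (\<forall>i<k. finite (N i) \<and> card (N i) = x i) \<and>
    (\<forall>l. card {i. i < k \<and> l \<in> N i} = card {i. i < k \<and> l \<in> {..<y i}})"
    using x le eq by (intro set_family_of_majorized_sizes[of _ _ _ y]) simp_all
  then obtain N where N: "\<And>i. i < k \<Longrightarrow> finite (N i)" "\<And>i. i < k \<Longrightarrow> card (N i) = x i"
    "\<And>l. card {i. i < k \<and> l \<in> N i} = c l"
    by (auto simp: c_def)
  define q where "q = y 0"
  \<comment> \<open>The conjugation rule for the Ferrers diagram of \<open>y\<close>.\<close>
  have c_ge: "Suc i \<le> c l \<longleftrightarrow> l < y i" if i: "i < k" for i l
  proof
    assume "l < y i"
    hence "{..i} \<subseteq> {j. j < k \<and> l < y j}"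
      using y i by (fastforce simp: monotone_on_def)
    hence "card {..i} \<le> c l" unfolding c_def by (intro card_mono) auto
    thus "Suc i \<le> c l" by simp
  next
    assume "Suc i \<le> c l"
    show "l < y i"
    proof (rule ccontr)
      assume "\<not> l < y i"
      have "j < i" if "j < k" "l < y j" for j
      proof (rule ccontr)
        assume "\<not> j < i"
        hence "y j \<le> y i" using y i that by (auto simp: monotone_on_def)
        thus False using that \<open>\<not> l < y i\<close> by simp
      qed
      hence "{j. j < k \<and> l < y j} \<subseteq> {..<i}" by blast
      hence "c l \<le> card {..<i}" unfolding c_def by (intro card_mono) auto
      thus False using \<open>Suc i \<le> c l\<close> by simp
    qed
  qed
  have c_le: "c l \<le> k" for l
    using card_mono[of "{..<k}" "{i. i < k \<and> l < y i}"] by (auto simp: c_def)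
  have N_sub: "N i \<subseteq> {..<q}" if i: "i < k" for i
  proof
    fix l assume "l \<in> N i"
    hence "{i. i < k \<and> l \<in> N i} \<noteq> {}" using i by blast
    hence "Suc 0 \<le> c l" unfolding N(3)[symmetric] by (simp add: Suc_le_eq card_gt_0_iff)
    thus "l \<in> {..<q}" using c_ge[OF k] by (simp add: q_def)
  qed
  define E where "E = pentagon_edges k N"
  interpret pentagon_join "{..<k}" "{k + 5..<k + 5 + q}" k "k + 1" "k + 2" "k + 3" "k + 4" E
    unfolding E_def using N_sub by (rule pentagon_join_pentagon_edges)
  have across: "{u, k + 5 + l} \<in> E \<longleftrightarrow> l \<in> N u" if "u < k" for u l
    using that by (simp add: E_def pentagon_edges_iff)
  have V: "V = {..<k + 5 + q}" by auto
  have deg_K: "degree E u = k + 4 + x u" if u: "u < k" for u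
  proof -
    have "{v \<in> {k + 5..<k + 5 + q}. {u, v} \<in> E} = (\<lambda>l. k + 5 + l) ` N u"
    proof (intro equalityI subsetI)
      fix v assume v: "v \<in> {v \<in> {k + 5..<k + 5 + q}. {u, v} \<in> E}"
      then obtain l where "v = k + 5 + l" using le_Suc_ex by auto
      thus "v \<in> (\<lambda>l. k + 5 + l) ` N u" using v across[OF u] by auto
    next
      fix v assume "v \<in> (\<lambda>l. k + 5 + l) ` N u"
      thus "v \<in> {v \<in> {k + 5..<k + 5 + q}. {u, v} \<in> E}"
        using across[OF u] N_sub[OF u] by auto
    qed
    moreover have "card ((\<lambda>l. k + 5 + l) ` N u) = x u"
      using N(2)[OF u] by (subst card_image) (auto simp: inj_on_def)
    ultimately show ?thesis using degree_clique[of u] u by simp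
  qed
  have deg_I: "degree E (k + 5 + l) = c l" if "l < q" for l
  proof -
    have "{u \<in> {..<k}. {u, k + 5 + l} \<in> E} = {u. u < k \<and> l \<in> N u}"
      using across by auto
    thus ?thesis using degree_independent[of "k + 5 + l"] that N(3)[of l] by simp
  qed
  let ?ds = "map (\<lambda>i. k + 4 + x i) [0..<k] @ replicate 5 (k + 2) @ map c [0..<q]"
  have "map (degree E) [0..<k + 5 + q] = ?ds"
  proof -
    have "[0..<k + 5 + q] = [0..<k] @ [k..<k + 5] @ [k + 5..<k + 5 + q]"
      by (metis add.assoc le_add1 upt_add_eq_append zero_le)
    moreover have "map (degree E) [0..<k] = map (\<lambda>i. k + 4 + x i) [0..<k]"
      using deg_K by simp
    moreover have "map (degree E) [k..<k + 5] = replicate 5 (k + 2)"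
      using degree_pentagon by (intro nth_equalityI) (auto simp: less_Suc_eq numeral_eq_Suc)
    moreover have "map (degree E) [k + 5..<k + 5 + q] = map c [0..<q]"
      using deg_I by (intro nth_equalityI) auto
    ultimately show ?thesis by simp
  qed
  hence "mset ?ds = image_mset (degree E) (mset_set V)"
    unfolding V by (metis atLeast0LessThan mset_map mset_upt)
  moreover have "sorted_wrt (\<ge>) ?ds"
  proof -
    have "sorted_wrt (\<ge>) (map (\<lambda>i. k + 4 + x i) [0..<k])"
      using x by (auto simp: sorted_wrt_iff_nth_less monotone_on_def)
    moreover have "c j \<le> c i" if "i \<le> j" for i j
      unfolding c_def using that by (intro card_mono) auto
    hence "sorted_wrt (\<ge>) (map c [0..<q])"
      by (auto simp: sorted_wrt_iff_nth_less)
    moreover have "sorted_wrt (\<ge>) (replicate 5 (k + 2))"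
      by (simp add: sorted_wrt_iff_nth_less)
    moreover have "c l \<le> k + 2" for l using c_le[of l] by simp
    moreover have "c l \<le> k + 4 + x i" for l i using c_le[of l] by simp
    ultimately show ?thesis by (auto simp: sorted_wrt_append)
  qed
  ultimately have seq: "degree_sequence V E = ?ds" by (intro degree_sequence_eqI)
  show thesis
  proof
    show "NG3_graph V E"
    proof (rule NG3_graph_pentagon_join)
      fix v assume v: "v \<in> {k + 5..<k + 5 + q}"
      then obtain l where l: "v = k + 5 + l" "l < q" using le_Suc_ex by fastforce
      have "0 < c l" using c_ge[OF k, of l] l by (simp add: q_def)
      hence "{i. i < k \<and> l \<in> N i} \<noteq> {}" using N(3)[of l] by (metis card.empty less_irrefl)
      thus "\<exists>u\<in>{..<k}. {u, v} \<in> E" using across l by auto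
    qed
    show "alpha_part (degree_sequence V E) = map (\<lambda>t. t + 4) (add_staircase k x) @ [2, 1]"
      unfolding seq using c_le by (intro alpha_part_pentagon_join) auto
    show "beta_part (degree_sequence V E) = map (\<lambda>t. t + 4) (add_staircase k y) @ [4, 3]"
      unfolding seq
    proof (rule beta_part_pentagon_join)
      fix i assume i: "i < k"
      have "y i \<le> q" using y k i by (auto simp: q_def monotone_on_def)
      hence "l < q \<and> Suc i \<le> c l \<longleftrightarrow> l < y i" for l
        using c_ge[OF i, of l] by (metis order_less_le_trans)
      hence "{l. l < q \<and> Suc i \<le> c l} = {..<y i}" by (simp only: lessThan_def)
      moreover have "{l. l < length (map c [0..<q]) \<and> Suc i \<le> map c [0..<q] ! l} =
        {l. l < q \<and> Suc i \<le> c l}" by auto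
      ultimately show "length (filter (\<lambda>c. Suc i \<le> c) (map c [0..<q])) = y i"
        by (simp only: length_filter_conv_card card_lessThan)
    qed (use c_le in auto)
  qed
qed


section \<open>Split blocks and NG-3 blocks\<close>

lemma majorizes_map_add:
  "majorizes (map (\<lambda>t. t + c) a) (map (\<lambda>t. t + c) b) \<longleftrightarrow> majorizes a b" if "length a = length b"
proof -
  have sum: "sum_list (map (\<lambda>t. t + c) xs) = sum_list xs + length xs * c" for xs :: "nat list"
    by (induction xs) auto
  show ?thesis using that by (auto simp: majorizes_same_length take_map sum)
qed

lemma majorizes_append_right:
  "majorizes (a @ t) (b @ t) \<longleftrightarrow> majorizes a b" if "length a = length b"
proof
  assume maj: "majorizes (a @ t) (b @ t)"
  have "sum_list (take m b) \<le> sum_list (take m a)" if m: "m \<le> length a" for m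
  proof -
    have "sum_list (take m (b @ t)) \<le> sum_list (take m (a @ t))"
      using maj m \<open>length a = length b\<close> by (simp add: majorizes_same_length del: take_append)
    thus ?thesis using m \<open>length a = length b\<close> by simp
  qed
  moreover have "sum_list b = sum_list a" using maj by (simp add: majorizes_def)
  ultimately show "majorizes a b" using that by (simp add: majorizes_same_length)
next
  assume "majorizes a b"
  hence eq: "sum_list b = sum_list a"
    and le: "\<And>m. m \<le> length a \<Longrightarrow> sum_list (take m b) \<le> sum_list (take m a)"
    using that by (simp_all add: majorizes_same_length)
  have "sum_list (take m b) \<le> sum_list (take m a)" for m
    using le[of m] eq that by (cases "m \<le> length a") simp_all
  thus "majorizes (a @ t) (b @ t)"
    using that eq by (simp add: majorizes_same_length)
qed

lemma Dis_pos: "a \<in> Dis n \<Longrightarrow> \<forall>x\<in>set a. 0 < x"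
  by (simp add: Dis_def)

lemma Dis_lenD: "a \<in> Dis_len k n \<Longrightarrow> a \<in> Dis n \<and> length a = k"
  by (simp add: Dis_len_def)

lemma A_blocks_iff:
  "(a, b) \<in> A_blocks m k \<longleftrightarrow>
    0 < m \<and> a \<in> Dis_len k m \<and> b \<in> Dis_len k m \<and> majorizes b a"
proof -
  have "majorizes b a \<longleftrightarrow> weakly_majorizes b a" if "a \<in> Dis_len k m" "b \<in> Dis_len k m"
    using that by (simp add: majorizes_def Dis_len_def Dis_def)
  thus ?thesis
    by (auto simp: A_blocks_def S_blocks_def blocks_def dest: Dis_lenD)
qed

lemma Dis_append:
  assumes "a \<in> Dis n" "b \<in> Dis m" "\<forall>x\<in>set a. \<forall>y\<in>set b. y < x"
  shows "a @ b \<in> Dis (n + m)"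
  using assms by (auto simp: Dis_def sorted_wrt_append)

lemma partial_order_blocks:
  assumes "\<And>a b. (a, b) \<in> S \<Longrightarrow> is_block (a, b)"
  shows "partial_order_on S (majorization_order S)"
proof (rule partial_order_majorization)
  fix a b assume "(a, b) \<in> S"
  thus "(\<forall>x\<in>set a. 0 < x) \<and> (\<forall>x\<in>set b. 0 < x)"
    using assms[of a b] by (auto simp: is_block_def blocks_def dest!: Dis_pos)
qed

text \<open>
\<open>S_blocks\<close> also has blocks with other numbers of parts. They do not come between elements of
\<open>A_blocks\<close>, because passing to a majorizing partition never increases the number of parts: the
four comparisons bound both lengths from above and from below by \<open>k\<close>.
\<close>

lemma S_block_between_same_length:
  assumes cd: "(c, d) \<in> S_blocks m"
    and above: "a0 \<in> Dis_len k m" "majorizes c a0" "b0 \<in> Dis_len k m" "majorizes b0 d"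
    and below: "a \<in> Dis_len k m" "majorizes a c" "majorizes d a"
  shows "(c, d) \<in> A_blocks m k"
proof -
  have Dis: "c \<in> Dis m" "d \<in> Dis m" "0 < m"
    using cd by (auto simp: S_blocks_def blocks_def)
  note len = majorizes_length[OF _ Dis_pos]
  have "length c \<le> k" "k \<le> length d" "k \<le> length c" "length d \<le> k"
    using len[OF above(2) Dis(1)] len[OF above(4)] len[OF below(2)] len[OF below(3) Dis(2)]
      Dis_lenD[OF above(1)] Dis_lenD[OF above(3)] Dis_lenD[OF below(1)] by auto
  moreover have "majorizes d c"
    using majorizes_trans[OF below(3,2)] Dis_pos Dis(2) Dis_lenD[OF below(1)] by blast
  ultimately show ?thesis
    using Dis by (simp add: A_blocks_iff Dis_len_def)
qed

text \<open>
Downwards in the block order the first component becomes smaller and the second one larger, so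
the extreme choices can be made independently, and they form a split block.
\<close>

lemma A_blocks_least:
  assumes "0 < k" and "(k + 1 choose 2) \<le> m"
  obtains a0 b0 where "(a0, b0) \<in> A_blocks m k"
    "\<And>a b. (a, b) \<in> A_blocks m k \<Longrightarrow> block_majorizes (a, b) (a0, b0)"
proof -
  have "0 < m"
    using assms by (auto intro: less_le_trans[rotated] simp: numeral_2_eq_2)
  moreover obtain a0 where "a0 \<in> Dis_len k m" "\<And>b. b \<in> Dis_len k m \<Longrightarrow> majorizes b a0"
    using Dis_len_least[OF assms] by blast
  moreover obtain b0 where "b0 \<in> Dis_len k m" "\<And>b. b \<in> Dis_len k m \<Longrightarrow> majorizes b0 b"
    using Dis_len_greatest[OF assms] by blast
  ultimately show thesis
    by (intro that[of a0 b0]) (auto simp: A_blocks_iff)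
qed

lemma diagonal_antichain:
  assumes "a \<in> Dis_len k m" "b \<in> Dis_len k m" "block_majorizes (b, b) (a, a)"
  shows "a = b"
proof (rule majorizes_antisym)
  show "majorizes a b" "majorizes b a" using assms(3) by simp_all
  show "\<forall>x\<in>set a. 0 < x" "\<forall>x\<in>set b. 0 < x"
    using assms(1,2) Dis_lenD Dis_pos by blast+
qed

text \<open>
The diagonal blocks form the rim of the amphora: every block lies below the one with the same
first component.
\<close>

lemma A_blocks_below_diagonal:
  assumes "(a, b) \<in> A_blocks m k"
  shows "(a, a) \<in> A_blocks m k" "block_majorizes (a, a) (a, b)"
  using assms by (auto simp: A_blocks_iff majorizes_refl)

lemma A_blocks_amphora:
  assumes "0 < k" and "(k + 1 choose 2) \<le> m"
  shows "amphora_in (S_blocks m) (majorization_order (S_blocks m)) (A_blocks m k)"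
proof -
  obtain a0 b0 where least: "(a0, b0) \<in> A_blocks m k"
    "\<And>a b. (a, b) \<in> A_blocks m k \<Longrightarrow> block_majorizes (a, b) (a0, b0)"
    using A_blocks_least[OF assms] by blast
  define D where "D = {(a, a) | a. (a, a) \<in> A_blocks m k}"
  have sub: "A_blocks m k \<subseteq> S_blocks m" by (auto simp: A_blocks_def)
  show ?thesis
    unfolding amphora_in_def
  proof (intro conjI exI[of _ D] exI[of _ "(a0, b0)"])
    show "partial_order_on (S_blocks m) (majorization_order (S_blocks m))"
      by (rule partial_order_blocks) (auto simp: S_blocks_def is_block_def)
    show "D \<subseteq> S_blocks m" "(a0, b0) \<in> S_blocks m"
      using sub least(1) by (auto simp: D_def)
    show "\<forall>p\<in>D. \<forall>q\<in>D. (p, q) \<in> majorization_order (S_blocks m) \<longrightarrow> p = q"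
    proof (intro ballI impI)
      fix p q assume "p \<in> D" "q \<in> D" "(p, q) \<in> majorization_order (S_blocks m)"
      thus "p = q"
        using diagonal_antichain[of _ k m]
        by (auto simp: D_def majorization_order_def A_blocks_iff simp del: block_majorizes.simps)
    qed
    show "\<forall>p\<in>D. ((a0, b0), p) \<in> majorization_order (S_blocks m)"
      using sub least by (auto simp: D_def majorization_order_def simp del: block_majorizes.simps)
    show "A_blocks m k = {y \<in> S_blocks m. ((a0, b0), y) \<in> majorization_order (S_blocks m) \<and>
      (\<exists>p\<in>D. (y, p) \<in> majorization_order (S_blocks m))}"
    proof (intro equalityI subsetI)
      fix y assume y: "y \<in> A_blocks m k"
      obtain a b where ab: "y = (a, b)" by (cases y)
      have "(a, a) \<in> D" using A_blocks_below_diagonal y ab by (auto simp: D_def)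
      thus "y \<in> {y \<in> S_blocks m. ((a0, b0), y) \<in> majorization_order (S_blocks m) \<and>
        (\<exists>p\<in>D. (y, p) \<in> majorization_order (S_blocks m))}"
        using y ab sub least A_blocks_below_diagonal[of a b m k]
        by (auto simp: majorization_order_def simp del: block_majorizes.simps)
    next
      fix y assume y: "y \<in> {y \<in> S_blocks m. ((a0, b0), y) \<in> majorization_order (S_blocks m) \<and>
        (\<exists>p\<in>D. (y, p) \<in> majorization_order (S_blocks m))}"
      obtain c d where cd: "y = (c, d)" by (cases y)
      obtain a where "(a, a) \<in> A_blocks m k" "block_majorizes (a, a) (c, d)"
        using y cd by (auto simp: D_def majorization_order_def)
      thus "y \<in> A_blocks m k"
        using y cd least(1) S_block_between_same_length[of c d m a0 k b0 a]
        by (auto simp: majorization_order_def A_blocks_iff)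
    qed
  qed
qed

text \<open>
The bijection of the theorem, in the direction from split blocks to NG-3 blocks. The shift by
\<open>4\<close> and the appended parts are the contribution of the pentagon.
\<close>

definition raise_block :: "block \<Rightarrow> block" where
  "raise_block p = (map (\<lambda>t. t + 4) (fst p) @ [2, 1], map (\<lambda>t. t + 4) (snd p) @ [4, 3])"

lemma block_majorizes_raise_block:
  assumes "p \<in> A_blocks m k" "q \<in> A_blocks m k"
  shows "block_majorizes (raise_block p) (raise_block q) \<longleftrightarrow> block_majorizes p q"
proof -
  obtain a b c d where "p = (a, b)" "q = (c, d)" by (cases p; cases q)
  thus ?thesis using assms
    by (auto simp: raise_block_def A_blocks_iff Dis_len_def majorizes_append_right majorizes_map_add)
qed

lemma inj_on_raise_block: "inj_on raise_block S"
proof -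
  have "inj (\<lambda>t::nat. t + 4)" by (simp add: inj_on_def)
  thus ?thesis
    by (auto simp: inj_on_def raise_block_def prod_eq_iff dest!: map_injective)
qed

lemma Dis_len_map_add:
  assumes "a \<in> Dis_len k m"
  shows "map (\<lambda>t. t + c) a \<in> Dis_len k (m + c * k)"
proof -
  have "sum_list (map (\<lambda>t. t + c) a) = sum_list a + c * length a" by (induction a) auto
  thus ?thesis using assms by (auto simp: Dis_len_def Dis_def sorted_wrt_map)
qed

lemma Dis_len_map_add_iff:
  "a \<in> Dis_len k (m + c * k) \<and> (\<forall>t\<in>set a. c < t) \<longleftrightarrow> a \<in> (map (\<lambda>t. t + c)) ` Dis_len k m"
proof
  assume a: "a \<in> Dis_len k (m + c * k) \<and> (\<forall>t\<in>set a. c < t)"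
  have eq: "a = map (\<lambda>t. t + c) (map (\<lambda>t. t - c) a)"
    using a by (intro nth_equalityI) (auto simp: less_imp_le)
  have "sum_list (map (\<lambda>t. t + c) xs) = sum_list xs + c * length xs" for xs :: "nat list"
    by (induction xs) auto
  from this[of "map (\<lambda>t. t - c) a"] have "sum_list (map (\<lambda>t. t - c) a) = m"
    using a eq by (simp add: Dis_len_def Dis_def)
  hence "map (\<lambda>t. t - c) a \<in> Dis_len k m"
    using a by (auto simp: Dis_len_def Dis_def sorted_wrt_iff_nth_less diff_less_mono less_imp_le)
  thus "a \<in> (map (\<lambda>t. t + c)) ` Dis_len k m" using eq by blast
next
  assume "a \<in> (map (\<lambda>t. t + c)) ` Dis_len k m"
  then obtain b where b: "b \<in> Dis_len k m" "a = map (\<lambda>t. t + c) b" by blast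
  thus "a \<in> Dis_len k (m + c * k) \<and> (\<forall>t\<in>set a. c < t)"
    using Dis_len_map_add[OF b(1), of c] Dis_lenD[OF b(1)] Dis_pos[of b m] by auto
qed

text \<open>
For a split block the second component majorizes the first, which is the dominance condition under
which a graph can be constructed.
\<close>

lemma raise_block_NG3:
  assumes k: "0 < k" and ab: "(a, b) \<in> A_blocks m k"
  shows "raise_block (a, b) \<in> NG3_blocks (m + 4 * k) k"
proof -
  let ?a = "map (\<lambda>t. t + 4) a" and ?b = "map (\<lambda>t. t + 4) b"
  have a: "a \<in> Dis_len k m" and b: "b \<in> Dis_len k m" and maj: "majorizes b a"
    using ab by (auto simp: A_blocks_iff)
  have a': "?a \<in> Dis_len k (m + 4 * k)" "\<forall>t\<in>set ?a. 5 \<le> t"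
    and b': "?b \<in> Dis_len k (m + 4 * k)" "\<forall>t\<in>set ?b. 5 \<le> t"
    using Dis_len_map_add_iff[of ?a k m 4] Dis_len_map_add_iff[of ?b k m 4] a b
    by (auto simp: Suc_le_eq)
  obtain x where x: "antimono_on {..<k} x" "a = add_staircase k x"
    using a by (rule Dis_len_add_staircase)
  obtain y where y: "antimono_on {..<k} y" "b = add_staircase k y"
    using b by (rule Dis_len_add_staircase)
  have xy: "(\<Sum>i<k. x i) = (\<Sum>i<k. y i)" "\<And>m. m \<le> k \<Longrightarrow> (\<Sum>i<m. x i) \<le> (\<Sum>i<m. y i)"
    using maj by (auto simp: x(2) y(2) majorizes_add_staircase)
  obtain V :: "nat set" and E where G: "NG3_graph V E"
    "alpha_part (degree_sequence V E) = ?a @ [2, 1]"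
    "beta_part (degree_sequence V E) = ?b @ [4, 3]"
    using NG3_graph_realization[OF k x(1) y(1) xy(2,1)] x(2) y(2) by blast
  have len: "length a = k" "length b = k" using a b by (simp_all add: Dis_len_def)
  have "majorizes ?b ?a" using maj len by (simp add: majorizes_map_add)
  have weak: "weakly_majorizes (?b @ [4, 3]) (?a @ [2, 1])"
  proof -
    have "sum_list (take i [2, 1]) \<le> sum_list (take i [4, 3::nat])" for i
      by (simp add: take_Cons split: nat.split)
    moreover have "sum_list (take i ?a) \<le> sum_list (take i ?b)" for i
      using \<open>majorizes ?b ?a\<close> len
      by (cases "i \<le> k") (auto simp: majorizes_same_length)
    moreover have "sum_list ?a = sum_list ?b"
      using \<open>majorizes ?b ?a\<close> by (simp add: majorizes_def)
    ultimately show ?thesis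
      using len by (simp add: weakly_majorizes_def add_mono)
  qed
  have "?a @ [2, 1] \<in> Dis (m + 4 * k + 3)" "?b @ [4, 3] \<in> Dis (m + 4 * k + 7)"
  proof -
    have "[2, 1] \<in> Dis 3" "[4, 3] \<in> Dis 7" by (simp_all add: Dis_def)
    moreover have "\<forall>t\<in>set ?a. \<forall>s\<in>set [2, 1]. s < t" "\<forall>t\<in>set ?b. \<forall>s\<in>set [4, 3]. s < t"
      using a'(2) b'(2) by auto
    ultimately show "?a @ [2, 1] \<in> Dis (m + 4 * k + 3)" "?b @ [4, 3] \<in> Dis (m + 4 * k + 7)"
      using a'(1) b'(1) by (blast intro: Dis_append dest: Dis_lenD)+
  qed
  moreover have "even (m + 4 * k + 3) = even (m + 4 * k + 7)" by simp
  ultimately have "(?a @ [2, 1], ?b @ [4, 3]) \<in> blocks (m + 4 * k + 3) (m + 4 * k + 7)"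
    using weak len by (simp add: blocks_def)
  hence "NG3_block (?a @ [2, 1], ?b @ [4, 3])"
    using G unfolding NG3_block_def is_block_def by metis
  moreover have "\<forall>t\<in>set ?a. 3 \<le> t" using a'(2) by auto
  ultimately show ?thesis
    using a' b' unfolding NG3_blocks_def raise_block_def by auto
qed

text \<open>
Undoing the shift requires all parts to exceed \<open>4\<close>. For \<open>b\<close> this is given, for \<open>a\<close> only a lower
bound of \<open>3\<close>. But \<open>b\<close> majorizes \<open>a\<close>, and comparing the prefixes of length \<open>k - 1\<close> with the common
total shows that the smallest part of \<open>a\<close> is at least that of \<open>b\<close>.
\<close>

lemma NG3_block_is_raised:
  assumes k: "0 < k" and m: "0 < m" and p: "p \<in> NG3_blocks (m + 4 * k) k"
  shows "p \<in> raise_block ` A_blocks m k"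
proof -
  obtain a b where ab: "p = (a @ [2, 1], b @ [4, 3])" "is_block (a @ [2, 1], b @ [4, 3])"
    "a \<in> Dis_len k (m + 4 * k)" "b \<in> Dis_len k (m + 4 * k)" "\<forall>t\<in>set b. 5 \<le> t"
    using p by (auto simp: NG3_blocks_def NG3_block_def)
  have len: "length a = k" "length b = k" using ab by (simp_all add: Dis_len_def)
  have maj: "majorizes b a"
  proof -
    have weak: "weakly_majorizes (b @ [4, 3]) (a @ [2, 1])"
      using ab(2) by (auto simp: is_block_def blocks_def)
    have "sum_list (take i a) \<le> sum_list (take i b)" if "i \<le> k" for i
    proof -
      have "sum_list (take i (a @ [2, 1])) \<le> sum_list (take i (b @ [4, 3]))"
        using weak that len by (simp add: weakly_majorizes_def del: take_append)
      thus ?thesis using that len by simp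
    qed
    thus ?thesis using ab(3,4) len by (simp add: majorizes_same_length Dis_len_def Dis_def)
  qed
  have last: "5 \<le> a ! (k - 1)"
  proof -
    have split: "sum_list xs = sum_list (take (k - 1) xs) + xs ! (k - 1)" if "length xs = k"
      for xs :: "nat list"
    proof -
      have "take (k - 1) xs @ [xs ! (k - 1)] = xs"
        using that k take_Suc_conv_app_nth[of "k - 1" xs] by simp
      thus ?thesis by (metis sum_list.Cons sum_list.Nil sum_list.append add.right_neutral)
    qed
    have "sum_list (take (k - 1) a) \<le> sum_list (take (k - 1) b)" "sum_list a = sum_list b"
      using maj len by (auto simp: majorizes_same_length)
    hence "b ! (k - 1) \<le> a ! (k - 1)" using split[OF len(1)] split[OF len(2)] by linarith
    moreover have "5 \<le> b ! (k - 1)" using ab(5) len k by simp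
    ultimately show ?thesis by simp
  qed
  have "\<forall>t\<in>set a. 4 < t"
  proof
    fix t assume "t \<in> set a"
    then obtain i where i: "i < k" "t = a ! i" using len by (auto simp: in_set_conv_nth)
    have "a ! (k - 1) + (k - 1 - i) \<le> a ! i"
      using ab(3) by (rule Dis_nth_gap) (use i in auto)
    thus "4 < t" using last i by simp
  qed
  then obtain a' where a': "a' \<in> Dis_len k m" "a = map (\<lambda>t. t + 4) a'"
    using Dis_len_map_add_iff[of a k m 4] ab(3) by auto
  obtain b' where b': "b' \<in> Dis_len k m" "b = map (\<lambda>t. t + 4) b'"
    using Dis_len_map_add_iff[of b k m 4] ab(4,5) by (auto simp: Suc_le_eq)
  have "majorizes b' a'"
    using maj a' b' by (simp add: Dis_len_def majorizes_map_add)
  hence "(a', b') \<in> A_blocks m k" using m a' b' by (simp add: A_blocks_iff)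
  moreover have "p = raise_block (a', b')" using ab a' b' by (simp add: raise_block_def)
  ultimately show ?thesis by blast
qed

lemma bij_betw_raise_block:
  assumes "0 < k" "0 < m"
  shows "bij_betw raise_block (A_blocks m k) (NG3_blocks (m + 4 * k) k)"
proof (rule bij_betw_imageI)
  show "raise_block ` A_blocks m k = NG3_blocks (m + 4 * k) k"
  proof (intro equalityI subsetI)
    fix p assume "p \<in> raise_block ` A_blocks m k"
    then obtain a b where "(a, b) \<in> A_blocks m k" "p = raise_block (a, b)" by auto
    thus "p \<in> NG3_blocks (m + 4 * k) k" using raise_block_NG3[OF assms(1)] by blast
  qed (rule NG3_block_is_raised[OF assms])
qed (rule inj_on_raise_block)

text \<open>
The bottom element and the antichain are the images of those of \<open>A_blocks\<close>; every NG-3 block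
of the poset lies between them.
\<close>

lemma NG3_blocks_amphora:
  assumes k: "0 < k" and m: "(k + 1 choose 2) \<le> m"
  defines "Q \<equiv> NG3_blocks (m + 4 * k) k"
  shows "amphora_in Q (majorization_order Q) Q"
proof -
  obtain a0 b0 where least: "(a0, b0) \<in> A_blocks m k"
    "\<And>a b. (a, b) \<in> A_blocks m k \<Longrightarrow> block_majorizes (a, b) (a0, b0)"
    using A_blocks_least[OF k m] by blast
  have "0 < m" using least(1) by (simp add: A_blocks_iff)
  have Q: "Q = raise_block ` A_blocks m k"
    using bij_betw_raise_block[OF k \<open>0 < m\<close>] by (simp add: Q_def bij_betw_def)
  have order: "(raise_block p, raise_block q) \<in> majorization_order Q \<longleftrightarrow> block_majorizes q p"
    if "p \<in> A_blocks m k" "q \<in> A_blocks m k" for p q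
    using that block_majorizes_raise_block[of q m k p] by (auto simp: majorization_order_def Q)
  define D where "D = raise_block ` {(a, a) | a. (a, a) \<in> A_blocks m k}"
  have above: "(raise_block (a0, b0), p) \<in> majorization_order Q" if "p \<in> Q" for p
    using that least order by (auto simp: Q simp del: block_majorizes.simps)
  have below: "\<exists>d\<in>D. (p, d) \<in> majorization_order Q" if p: "p \<in> Q" for p
  proof -
    obtain a b where ab: "p = raise_block (a, b)" "(a, b) \<in> A_blocks m k" using p by (auto simp: Q)
    hence "(p, raise_block (a, a)) \<in> majorization_order Q"
      using A_blocks_below_diagonal[of a b m k] by (simp add: order)
    thus ?thesis using A_blocks_below_diagonal(1)[OF ab(2)] by (auto simp: D_def)
  qed
  show ?thesis
    unfolding amphora_in_def
  proof (intro conjI exI[of _ D] exI[of _ "raise_block (a0, b0)"])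
    show "partial_order_on Q (majorization_order Q)"
      by (rule partial_order_blocks) (auto simp: Q_def NG3_blocks_def NG3_block_def)
    show "D \<subseteq> Q" by (auto simp: D_def Q)
    thus "\<forall>p\<in>D. (raise_block (a0, b0), p) \<in> majorization_order Q" using above by blast
    show "raise_block (a0, b0) \<in> Q" using least(1) by (auto simp: Q)
    show "\<forall>p\<in>D. \<forall>q\<in>D. (p, q) \<in> majorization_order Q \<longrightarrow> p = q"
    proof (intro ballI impI)
      fix p q assume "p \<in> D" "q \<in> D" "(p, q) \<in> majorization_order Q"
      moreover then obtain a b where "p = raise_block (a, a)" "(a, a) \<in> A_blocks m k"
        "q = raise_block (b, b)" "(b, b) \<in> A_blocks m k" by (auto simp: D_def)
      ultimately show "p = q"
        using diagonal_antichain[of a k m b] order[of "(a, a)" "(b, b)"]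
        by (simp add: A_blocks_iff del: block_majorizes.simps)
    qed
    show "Q = {y \<in> Q. (raise_block (a0, b0), y) \<in> majorization_order Q \<and>
      (\<exists>a\<in>D. (y, a) \<in> majorization_order Q)}"
      using above below by blast
  qed
qed

theorem theorem6p7:
  fixes n k :: nat
  assumes "0 < n" and "0 < k" and "n \<ge> 4 * k + (k + 1 choose 2)"
  shows "amphora_in (NG3_blocks n k) (majorization_order (NG3_blocks n k)) (NG3_blocks n k) \<and>
    amphora_in (S_blocks (n - 4 * k)) (majorization_order (S_blocks (n - 4 * k)))
      (A_blocks (n - 4 * k) k) \<and>
    (\<exists>\<phi>. bij_betw \<phi> (NG3_blocks n k) (A_blocks (n - 4 * k) k) \<and>
      (\<forall>x \<in> NG3_blocks n k. \<forall>y \<in> NG3_blocks n k.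
         block_majorizes x y \<longleftrightarrow> block_majorizes (\<phi> x) (\<phi> y)))"
proof -
  define m where "m = n - 4 * k"
  have m: "(k + 1 choose 2) \<le> m" and n: "n = m + 4 * k"
    using assms(3) by (simp_all add: m_def)
  obtain p where "p \<in> A_blocks m k" using A_blocks_least[OF assms(2) m] by blast
  hence "0 < m" by (cases p) (simp add: A_blocks_iff)
  hence bij: "bij_betw raise_block (A_blocks m k) (NG3_blocks n k)"
    unfolding n using assms(2) by (intro bij_betw_raise_block)
  define \<phi> where "\<phi> = inv_into (A_blocks m k) raise_block"
  have \<phi>: "bij_betw \<phi> (NG3_blocks n k) (A_blocks m k)"
    unfolding \<phi>_def using bij by (rule bij_betw_inv_into)
  have "block_majorizes x y \<longleftrightarrow> block_majorizes (\<phi> x) (\<phi> y)"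
    if "x \<in> NG3_blocks n k" "y \<in> NG3_blocks n k" for x y
  proof -
    have "\<phi> x \<in> A_blocks m k" "\<phi> y \<in> A_blocks m k"
      using \<phi> that by (auto simp: bij_betw_def)
    moreover have "raise_block (\<phi> x) = x" "raise_block (\<phi> y) = y"
      unfolding \<phi>_def using bij that by (simp_all add: bij_betw_inv_into_right)
    ultimately show ?thesis using block_majorizes_raise_block[of "\<phi> x" m k "\<phi> y"] by simp
  qed
  thus ?thesis
    using NG3_blocks_amphora[OF assms(2) m] A_blocks_amphora[OF assms(2) m] \<phi>
    unfolding m_def[symmetric] n[symmetric] by blast
qed

end
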